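(* There exist absolute constants $0<c<C$ and $n_0$ such that for every $n\ge n_0$, if $G\sim G(n,1/2)$ then $$e^{-Cn}\le \mathbb{P}(G\text{ is not even-degenerate})\le e^{-cn}.$$
   Context: $G(n,1/2)$ is the uniformly random graph on $n$ labelled vertices (each pair an edge independently with probability $1/2$). A graph $G$ on $n$ vertices is even-degenerate if there is an ordering $v_1,\dots,v_n$ of its vertices such that for each $1\le i\le n-2$, $v_i$ has an even number of neighbours in $\{v_{i+1},\dots,v_n\}$. (No parity condition is imposed on $e(G)$, and no condition on the pair $v_{n-1},v_n$.) *)

theory Defs
  imports "HOL-Probability.Probability"
begin

definition all_edges :: "nat \<Rightarrow> nat set set" where
  "all_edges n = {e. \<exists>u v. u < v \<and> v < n \<and> e = {u, v}}"

definition graphs :: "nat \<Rightarrow> nat set set set" where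
  "graphs n = Pow (all_edges n)"

definition Gnp_half :: "nat \<Rightarrow> nat set set pmf" where
  "Gnp_half n = pmf_of_set (graphs n)"

text \<open>Even-degenerate: an ordering vs!0, ..., vs!(n-1) of the vertices such that for every
  position i with i+2 < n (i.e. 1 <= i+1 <= n-2 in 1-indexed terms), vertex vs!i has an even
  number of neighbours among the later vertices.\<close>
definition even_degenerate :: "nat \<Rightarrow> nat set set \<Rightarrow> bool" where
  "even_degenerate n E \<longleftrightarrow>
     (\<exists>vs. distinct vs \<and> set vs = {..<n} \<and>
        (\<forall>i. i + 2 < n \<longrightarrow> even (card {j. i < j \<and> j < n \<and> {vs ! i, vs ! j} \<in> E})))"

end

theory Submission
  imports Defs "HOL-Real_Asymp.Real_Asymp"
begin

text \<open>
  Removing a vertex of even degree preserves the parity of the number of edges. A partial elimination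
  is a pair \<open>B \<subseteq> A\<close> such that \<open>A\<close> is reached from the whole graph by removing vertices of even degree,
  while \<open>B\<close> is built up from a pair of vertices, adjacent iff \<open>e(G)\<close> is odd, by adding vertices with an
  even number of neighbours in the current set; it leaves \<open>U = A - B\<close> unassigned. For fixed \<open>U\<close>, let \<open>N(U)\<close> be the number of
  partial eliminations leaving \<open>U\<close>. If \<open>v \<in> U\<close> has odd degree in \<open>G[U]\<close>, each \<open>B\<close> extends in exactly
  one way to \<open>U - v\<close>, so \<open>N\<close> does not drop. If \<open>v\<close> has even degree in \<open>G[U]\<close>, each \<open>B\<close> to which \<open>v\<close>
  sends an even number of edges extends in two ways and the others in none. If \<open>v, w \<in> U\<close> are adjacent,
  \<open>v\<close> even and \<open>w\<close> odd in \<open>G[U]\<close>, then \<open>N(U - v - w) \<ge> N(U) + #{B. v even to B}\<close>.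

  Upper bound: examine fresh pairs \<open>v, w\<close> and process a pair only if \<open>N\<close> grows by a factor \<open>5/4\<close>; each
  pair is accepted with probability at least \<open>1/24\<close>, so after linearly many pairs \<open>N\<close> is exponentially
  large outside an event of exponentially small probability. Then process the remaining fresh vertices
  one at a time: the parities of a fresh \<open>v\<close> to distinct sets \<open>B\<close> are pairwise independent, so by Chebyshev
  \<open>N\<close> is almost preserved with failure probability \<open>O(n\<^sup>2 / N)\<close>. After every such step the first rejected
  vertex has odd degree in \<open>G[U]\<close> with probability \<open>1/2\<close> and is then processed for free. Once a
  single vertex is left, edge parity forces the last step to succeed.

  Lower bound: any graph on an odd number of vertices extends by one vertex to a graph with all degrees
  odd; if \<open>n\<close> is odd, one more isolated vertex is added.
\<close>

section \<open>Partial eliminations\<close>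

definition odd_deg :: "nat set set \<Rightarrow> nat \<Rightarrow> nat set \<Rightarrow> bool" where
  "odd_deg E v S \<longleftrightarrow> odd (card {u \<in> S. {u, v} \<in> E})"

text \<open>The initial part of an elimination order. The degree is taken in the set that still
  contains \<open>v\<close>; without loops this is the number of later neighbours.\<close>

inductive reach :: "nat set set \<Rightarrow> nat set \<Rightarrow> nat set \<Rightarrow> bool" for E V where
  reach_refl: "reach E V V"
| reach_remove: "reach E V (insert v A) \<Longrightarrow> v \<notin> A \<Longrightarrow> \<not> odd_deg E v (insert v A) \<Longrightarrow> reach E V A"

text \<open>The final part of an elimination order, read backwards from its last pair, on which
  even-degeneracy imposes nothing. Prescribing the adjacency of that pair fixes the edge parity of
  every set grown from it.\<close>

inductive built :: "nat set set \<Rightarrow> bool \<Rightarrow> nat set \<Rightarrow> bool" for E \<kappa> where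
  built_pair: "x \<noteq> y \<Longrightarrow> ({x, y} \<in> E) = \<kappa> \<Longrightarrow> built E \<kappa> {x, y}"
| built_add: "built E \<kappa> B \<Longrightarrow> v \<notin> B \<Longrightarrow> \<not> odd_deg E v B \<Longrightarrow> built E \<kappa> (insert v B)"

text \<open>For fixed \<open>U\<close> the upper set is \<open>B \<union> U\<close>, so a partial
  elimination is recorded by \<open>B\<close> alone, and orders leading to the same \<open>B\<close>
  are identified.\<close>

definition states :: "nat set \<Rightarrow> bool \<Rightarrow> nat set set \<Rightarrow> nat set \<Rightarrow> nat set set" where
  "states V \<kappa> E U = {B. B \<subseteq> V - U \<and> built E \<kappa> B \<and> reach E V (B \<union> U)}"

lemma built_finite: "built E \<kappa> B \<Longrightarrow> finite B"
  by (induction rule: built.induct) auto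

lemma built_nonempty: "built E \<kappa> B \<Longrightarrow> B \<noteq> {}"
  by (induction rule: built.induct) auto

lemma reach_subset: "reach E V A \<Longrightarrow> A \<subseteq> V"
  by (induction rule: reach.induct) auto

lemma finite_states: "finite V \<Longrightarrow> finite (states V \<kappa> E U)"
  by (rule finite_subset[of _ "Pow V"]) (auto simp: states_def)

lemma odd_card_Un_disjoint:
  assumes "finite A" "finite B" "A \<inter> B = {}"
  shows "odd (card (A \<union> B)) \<longleftrightarrow> odd (card A) \<noteq> odd (card B)"
  using assms by (simp add: card_Un_disjoint)

lemma odd_deg_Un:
  assumes "finite A" "finite B" "A \<inter> B = {}"
  shows "odd_deg E v (A \<union> B) \<longleftrightarrow> odd_deg E v A \<noteq> odd_deg E v B"
proof -
  let ?X = "{u \<in> A. {u, v} \<in> E}" and ?Y = "{u \<in> B. {u, v} \<in> E}"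
  have "odd (card (?X \<union> ?Y)) \<longleftrightarrow> odd (card ?X) \<noteq> odd (card ?Y)"
    using assms by (intro odd_card_Un_disjoint) auto
  moreover have "{u \<in> A \<union> B. {u, v} \<in> E} = ?X \<union> ?Y" by auto
  ultimately show ?thesis by (simp only: odd_deg_def)
qed

lemma odd_deg_single: "odd_deg E v {u} \<longleftrightarrow> {u, v} \<in> E"
proof -
  have "{w \<in> {u}. {w, v} \<in> E} = (if {u, v} \<in> E then {u} else {})" by auto
  then show ?thesis by (auto simp: odd_deg_def)
qed

lemma odd_deg_insert:
  assumes "finite A" "u \<notin> A"
  shows "odd_deg E v (insert u A) \<longleftrightarrow> odd_deg E v A \<noteq> ({u, v} \<in> E)"
  using odd_deg_Un[of A "{u}" E v] assms by (simp add: odd_deg_single)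

lemma odd_deg_remove:
  assumes "finite A" "u \<in> A"
  shows "odd_deg E v (A - {u}) \<longleftrightarrow> odd_deg E v A \<noteq> ({u, v} \<in> E)"
  using odd_deg_insert[of "A - {u}" u E v] assms by (auto simp: insert_absorb)

text \<open>Moving \<open>v\<close> from \<open>U\<close> into the lower set leaves
  \<open>B \<union> U\<close> as it is, so only a building step has to be justified.\<close>

lemma states_bottom:
  assumes "B \<in> states V \<kappa> E U" "v \<in> U" "U \<subseteq> V" "\<not> odd_deg E v B"
  shows "insert v B \<in> states V \<kappa> E (U - {v})"
proof -
  have "insert v B \<union> (U - {v}) = B \<union> U" using assms by auto
  then show ?thesis using assms by (auto simp: states_def intro!: built_add)
qed

text \<open>The degree of \<open>v\<close> in the upper set is the sum of its degrees into the
  disjoint sets \<open>B\<close> and \<open>U\<close>, hence even when the two parities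
  coincide.\<close>

lemma states_top:
  assumes "B \<in> states V \<kappa> E U" "v \<in> U" "finite U" "odd_deg E v B = odd_deg E v U"
  shows "B \<in> states V \<kappa> E (U - {v})"
proof -
  have B: "B \<subseteq> V - U" "built E \<kappa> B" "reach E V (B \<union> U)" using assms by (auto simp: states_def)
  have "\<not> odd_deg E v (B \<union> U)"
    using odd_deg_Un[OF built_finite[OF B(2)] assms(3), of E v] B(1) assms(4) by blast
  moreover have "insert v (B \<union> (U - {v})) = B \<union> U" using assms by auto
  moreover have "v \<notin> B \<union> (U - {v})" using B(1) assms(2) by auto
  ultimately have "reach E V (B \<union> (U - {v}))"
    using B(3) by (metis reach_remove)
  then show ?thesis using B(1,2) by (auto simp: states_def)
qed

text \<open>The injection removes \<open>v\<close> from the top if it is odd to \<open>B\<close> and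
  adds it at the bottom otherwise; deleting \<open>v\<close> from the image recovers
  \<open>B\<close>.\<close>

lemma card_states_remove_odd:
  assumes V: "finite V" and U: "U \<subseteq> V" and v: "v \<in> U" and odd: "odd_deg E v U"
  shows "card (states V \<kappa> E U) \<le> card (states V \<kappa> E (U - {v}))"
proof (rule card_inj_on_le)
  have fU: "finite U" using V U finite_subset by blast
  define f where "f = (\<lambda>B. if odd_deg E v B then B else insert v B)"
  show "f ` states V \<kappa> E U \<subseteq> states V \<kappa> E (U - {v})"
    using states_bottom[OF _ v U] states_top[OF _ v fU] odd by (auto simp: f_def)
  show "inj_on f (states V \<kappa> E U)"
    by (rule inj_on_inverseI[where g = "\<lambda>B. B - {v}"]) (use v in \<open>auto simp: f_def states_def\<close>)
  show "finite (states V \<kappa> E (U - {v}))" by (rule finite_states[OF V])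
qed

text \<open>If \<open>v\<close> is even to both \<open>U\<close> and \<open>B\<close>, both moves
  are legal, and their results differ in whether they contain \<open>v\<close>.\<close>

lemma card_states_remove_even:
  assumes V: "finite V" and U: "U \<subseteq> V" and v: "v \<in> U" and even: "\<not> odd_deg E v U"
  shows "2 * card {B \<in> states V \<kappa> E U. \<not> odd_deg E v B} \<le> card (states V \<kappa> E (U - {v}))"
proof -
  have fU: "finite U" using V U finite_subset by blast
  define S where "S = {B \<in> states V \<kappa> E U. \<not> odd_deg E v B}"
  have fS: "finite S" using finite_states[OF V] by (simp add: S_def)
  have nv: "v \<notin> B" if "B \<in> S" for B using that v by (auto simp: S_def states_def)
  have "inj_on (insert v) S" using nv by (intro inj_onI) (simp add: insert_ident)
  then have c: "card (insert v ` S) = card S" by (rule card_image)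
  have "S \<inter> insert v ` S = {}" using nv by auto
  then have "card (S \<union> insert v ` S) = 2 * card S" using fS c by (simp add: card_Un_disjoint)
  moreover have "S \<union> insert v ` S \<subseteq> states V \<kappa> E (U - {v})"
    using states_bottom[OF _ v U] states_top[OF _ v fU] even by (auto simp: S_def)
  ultimately show ?thesis unfolding S_def[symmetric]
    by (metis card_mono finite_states[OF V])
qed

text \<open>Because of the edge \<open>vw\<close>, moving one of the two vertices flips the parity
  that the other one sees, which makes a suitable second move legal.\<close>

lemma card_states_remove_pair:
  assumes V: "finite V" and U: "U \<subseteq> V" and v: "v \<in> U" and w: "w \<in> U" and vw: "v \<noteq> w"
    and adj: "{v, w} \<in> E" and evenv: "\<not> odd_deg E v U" and oddw: "odd_deg E w U"
  shows "card (states V \<kappa> E U) + card {B \<in> states V \<kappa> E U. \<not> odd_deg E v B} \<le> card (states V \<kappa> E (U - {v, w}))"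
proof -
  have fU: "finite U" using V U finite_subset by blast
  define S where "S = states V \<kappa> E U"
  define S0 where "S0 = {B \<in> S. \<not> odd_deg E v B}"
  \<comment> \<open>\<open>f\<close> sends \<open>v\<close> and \<open>w\<close> to the same side
    and works for every state; \<open>g\<close> sends them to opposite sides and needs
    \<open>v\<close> even to \<open>B\<close>. Deleting both vertices recovers \<open>B\<close>, so
    both maps are injective with disjoint images.\<close>
  define f where "f = (\<lambda>B. if odd_deg E w B = odd_deg E v B then B else insert v (insert w B))"
  define g where "g = (\<lambda>B. if odd_deg E w B then insert v B else insert w B)"
  have fS: "finite S" "finite S0" using finite_states[OF V] by (auto simp: S_def S0_def)
  have nvw: "v \<notin> B" "w \<notin> B" "finite B" if "B \<in> S" for B
    using that v w by (auto simp: S_def states_def dest: built_finite)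
  have Uw: "U - {w} - {v} = U - {v, w}" "U - {v} - {w} = U - {v, w}" by auto
  have dvUw: "odd_deg E v (U - {w})"
    using odd_deg_remove[OF fU w, of E v] adj evenv by (simp add: insert_commute)
  have dwUv: "\<not> odd_deg E w (U - {v})"
    using odd_deg_remove[OF fU v, of E w] adj oddw by simp
  have f_in: "f B \<in> states V \<kappa> E (U - {v, w})" if B: "B \<in> S" for B
  proof -
    have B': "B \<in> states V \<kappa> E U" using B by (simp add: S_def)
    have i: "odd_deg E v (insert w B) \<longleftrightarrow> \<not> odd_deg E v B"
      using odd_deg_insert[of B w E v] nvw[OF B] adj by (simp add: insert_commute)
    have vin: "v \<in> U - {w}" "U - {w} \<subseteq> V" "finite (U - {w})" "w \<in> U - {v}"
      "U - {v} \<subseteq> V" "finite (U - {v})" using v w vw U fU by auto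
    have j: "odd_deg E w (insert v B) \<longleftrightarrow> \<not> odd_deg E w B"
      using odd_deg_insert[of B v E w] nvw[OF B] adj by simp
    show ?thesis
    proof (cases "odd_deg E w B")
      case True
      have 1: "B \<in> states V \<kappa> E (U - {w})" using states_top[OF B' w fU] True oddw by simp
      show ?thesis
      proof (cases "odd_deg E v B")
        case T: True
        then show ?thesis using states_top[OF 1 vin(1,3)] dvUw True Uw by (simp add: f_def)
      next
        case F: False
        have "insert v B \<in> states V \<kappa> E (U - {v})" using states_bottom[OF B' v U] F by simp
        then have "insert w (insert v B) \<in> states V \<kappa> E (U - {v} - {w})"
          using states_bottom[of "insert v B" V \<kappa> E "U - {v}" w] j True vin by simp
        then show ?thesis using True F Uw by (simp add: f_def insert_commute)
      qed
    next
      case False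
      show ?thesis
      proof (cases "odd_deg E v B")
        case T: True
        have "insert w B \<in> states V \<kappa> E (U - {w})" using states_bottom[OF B' w U] False by simp
        then have "insert v (insert w B) \<in> states V \<kappa> E (U - {w} - {v})"
          using states_bottom[of "insert w B" V \<kappa> E "U - {w}" v] i T vin by simp
        then show ?thesis using T False Uw by (simp add: f_def)
      next
        case F: False
        have "B \<in> states V \<kappa> E (U - {v})" using states_top[OF B' v fU] F evenv by simp
        then have "B \<in> states V \<kappa> E (U - {v} - {w})"
          using states_top[of B V \<kappa> E "U - {v}" w] dwUv False vin by simp
        then show ?thesis using F False Uw by (simp add: f_def)
      qed
    qed
  qed
  have g_in: "g B \<in> states V \<kappa> E (U - {v, w})" if B: "B \<in> S0" for B
  proof -
    have B': "B \<in> states V \<kappa> E U" "\<not> odd_deg E v B" "B \<in> S" using B by (auto simp: S_def S0_def)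
    have vin: "v \<in> U - {w}" "U - {w} \<subseteq> V" "finite (U - {w})" "w \<in> U - {v}"
      "U - {v} \<subseteq> V" "finite (U - {v})" using v w vw U fU by auto
    have i: "odd_deg E v (insert w B)"
      using odd_deg_insert[of B w E v] nvw[OF B'(3)] adj B'(2) by (simp add: insert_commute)
    have j: "odd_deg E w (insert v B) \<longleftrightarrow> \<not> odd_deg E w B"
      using odd_deg_insert[of B v E w] nvw[OF B'(3)] adj by simp
    show ?thesis
    proof (cases "odd_deg E w B")
      case True
      have "insert v B \<in> states V \<kappa> E (U - {v})" using states_bottom[OF B'(1) v U] B'(2) by simp
      then have "insert v B \<in> states V \<kappa> E (U - {v} - {w})"
        using states_top[of "insert v B" V \<kappa> E "U - {v}" w] dwUv j True vin by simp
      then show ?thesis using True Uw by (simp add: g_def)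
    next
      case False
      have "insert w B \<in> states V \<kappa> E (U - {w})" using states_bottom[OF B'(1) w U] False by simp
      then have "insert w B \<in> states V \<kappa> E (U - {w} - {v})"
        using states_top[of "insert w B" V \<kappa> E "U - {w}" v] i dvUw vin by simp
      then show ?thesis using False Uw by (simp add: g_def)
    qed
  qed
  have trace: "f B - {v, w} = B" "g B - {v, w} = B" if "B \<in> S" for B
    using nvw[OF that] by (auto simp: f_def g_def)
  have "inj_on f S" using trace(1) by (rule inj_on_inverseI)
  moreover have "inj_on g S0" using trace(2) by (rule inj_on_inverseI) (simp add: S0_def)
  moreover have "f ` S \<inter> g ` S0 = {}"
  proof -
    have "f B \<noteq> g C" if "B \<in> S" "C \<in> S0" for B C
    proof
      assume e: "f B = g C"
      have C: "C \<in> S" using that by (simp add: S0_def)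
      have "B = C" using trace(1)[OF that(1)] trace(2)[OF C] e by simp
      then have "f C = g C" using e by simp
      then show False using nvw[OF C] vw by (auto simp: f_def g_def split: if_splits)
    qed
    then show ?thesis by blast
  qed
  ultimately have "card (f ` S \<union> g ` S0) = card S + card S0"
    using fS by (simp add: card_Un_disjoint card_image)
  moreover have "f ` S \<union> g ` S0 \<subseteq> states V \<kappa> E (U - {v, w})" using f_in g_in by auto
  ultimately show ?thesis
    using card_mono[OF finite_states[OF V], of "f ` S \<union> g ` S0" \<kappa> E "U - {v, w}"]
    by (simp add: S_def S0_def)
qed

section \<open>What a partial elimination depends on\<close>

text \<open>The information exposed once the vertices of \<open>M\<close> have been examined: the
  edges inside \<open>M\<close>, but only one parity bit per vertex about the edges leaving
  \<open>M\<close>.\<close>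

definition agree :: "nat set \<Rightarrow> nat set \<Rightarrow> nat set set \<Rightarrow> nat set set \<Rightarrow> bool" where
  "agree V M E E' \<longleftrightarrow>
     (\<forall>m\<in>M. \<forall>m'\<in>M. ({m, m'} \<in> E) = ({m, m'} \<in> E')) \<and>
     (\<forall>m\<in>M. odd_deg E m (V - M) = odd_deg E' m (V - M))"

lemma agree_sym: "agree V M E E' \<Longrightarrow> agree V M E' E"
  by (auto simp: agree_def)

lemma agree_odd_deg_inside:
  assumes "agree V M E E'" "m \<in> M" "S \<subseteq> M"
  shows "odd_deg E m S = odd_deg E' m S"
proof -
  have "{u \<in> S. {u, m} \<in> E} = {u \<in> S. {u, m} \<in> E'}" using assms by (auto simp: agree_def)
  then show ?thesis by (simp add: odd_deg_def)
qed

lemma agree_odd_deg: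
  assumes "finite V" "agree V M E E'" "m \<in> M" "V - M \<subseteq> U" "U \<subseteq> V"
  shows "odd_deg E m U = odd_deg E' m U"
proof -
  have U: "U = (U \<inter> M) \<union> (V - M)" and f: "finite (U \<inter> M)" "finite (V - M)"
    and d: "(U \<inter> M) \<inter> (V - M) = {}"
    using assms by (auto intro: finite_subset[of _ V])
  have "odd_deg E m ((U \<inter> M) \<union> (V - M)) = odd_deg E' m ((U \<inter> M) \<union> (V - M))"
    unfolding odd_deg_Un[OF f d] using agree_odd_deg_inside[OF assms(2,3), of "U \<inter> M"] assms(2,3)
    by (simp add: agree_def)
  then show ?thesis using U by simp
qed

lemma agree_antimono:
  assumes "finite V" "agree V M E E'" "M' \<subseteq> M"
  shows "agree V M' E E'"
  unfolding agree_def
proof (intro conjI ballI)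
  fix m m' assume "m \<in> M'" "m' \<in> M'"
  then show "({m, m'} \<in> E) = ({m, m'} \<in> E')" using assms by (auto simp: agree_def)
next
  fix m assume "m \<in> M'"
  then show "odd_deg E m (V - M') = odd_deg E' m (V - M')"
    using assms by (intro agree_odd_deg[OF assms(1,2)]) auto
qed

text \<open>Every set along the way contains \<open>U\<close>, so the degree of a removed vertex
  splits into edges inside \<open>V - U\<close> and its parity into the whole of
  \<open>U\<close>.\<close>

lemma agree_reach:
  assumes "finite V" "agree V (V - U) E E'" "U \<subseteq> V"
  shows "reach E V A \<Longrightarrow> U \<subseteq> A \<Longrightarrow> reach E' V A"
proof (induction rule: reach.induct)
  case reach_refl
  show ?case by (rule reach.reach_refl)
next
  case (reach_remove v A)
  have "v \<in> V - U" using reach_subset[OF reach_remove(1)] reach_remove by auto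
  moreover have "V - (V - U) \<subseteq> insert v A" using reach_remove by auto
  ultimately have "odd_deg E v (insert v A) = odd_deg E' v (insert v A)"
    by (rule agree_odd_deg[OF assms(1,2)]) (rule reach_subset[OF reach_remove(1)])
  then show ?case using reach_remove by (metis reach.reach_remove subset_insertI2)
qed

lemma agree_built:
  assumes "agree V (V - U) E E'"
  shows "built E \<kappa> B \<Longrightarrow> B \<subseteq> V - U \<Longrightarrow> built E' \<kappa> B"
proof (induction rule: built.induct)
  case (built_pair x y)
  then show ?case using assms by (intro built.built_pair) (auto simp: agree_def)
next
  case (built_add B v)
  then show ?case using agree_odd_deg_inside[OF assms, of v B] by (intro built.built_add) auto
qed

lemma agree_states:
  assumes V: "finite V" and a: "agree V (V - U) E E'" and U: "U \<subseteq> V"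
  shows "states V \<kappa> E U = states V \<kappa> E' U"
proof -
  have "states V \<kappa> E U \<subseteq> states V \<kappa> E' U" if "agree V (V - U) E E'" for E E'
    using agree_reach[OF V that U] agree_built[OF that] by (auto simp: states_def)
  then show ?thesis using a agree_sym[OF a] by blast
qed

section \<open>From partial to complete eliminations\<close>

text \<open>Even-degeneracy relative to an arbitrary vertex set, so that orders can be lengthened
  one vertex at a time.\<close>

definition eliminable :: "nat set set \<Rightarrow> nat set \<Rightarrow> bool" where
  "eliminable E S \<longleftrightarrow> (\<exists>xs. distinct xs \<and> set xs = S \<and>
     (\<forall>i. i + 2 < length xs \<longrightarrow> even (card {j. i < j \<and> j < length xs \<and> {xs ! i, xs ! j} \<in> E})))"

text \<open>\<open>v\<close> goes to the front: its later neighbours are its neighbours in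
  \<open>S\<close>, and all other positions shift by one.\<close>

lemma eliminable_insert:
  assumes "eliminable E S" "v \<notin> S" "\<not> odd_deg E v S"
  shows "eliminable E (insert v S)"
proof -
  obtain xs where xs: "distinct xs" "set xs = S"
    "\<And>i. i + 2 < length xs \<Longrightarrow> even (card {j. i < j \<and> j < length xs \<and> {xs ! i, xs ! j} \<in> E})"
    using assms(1) by (auto simp: eliminable_def)
  let ?ys = "v # xs"
  have "even (card {j. i < j \<and> j < length ?ys \<and> {?ys ! i, ?ys ! j} \<in> E})"
    if "i + 2 < length ?ys" for i
  proof (cases i)
    case 0
    have "bij_betw (\<lambda>j. ?ys ! j) {j. 0 < j \<and> j < length ?ys \<and> {?ys ! 0, ?ys ! j} \<in> E}
        {u \<in> S. {u, v} \<in> E}"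
    proof (rule bij_betw_imageI)
      show "inj_on (\<lambda>j. ?ys ! j) {j. 0 < j \<and> j < length ?ys \<and> {?ys ! 0, ?ys ! j} \<in> E}"
        using xs assms(2) by (intro inj_on_nth) (auto simp del: nth_Cons_0)
      show "(\<lambda>j. ?ys ! j) ` {j. 0 < j \<and> j < length ?ys \<and> {?ys ! 0, ?ys ! j} \<in> E} = {u \<in> S. {u, v} \<in> E}"
      proof (intro subset_antisym subsetI)
        fix u assume "u \<in> {u \<in> S. {u, v} \<in> E}"
        then obtain k where k: "k < length xs" "xs ! k = u" "{u, v} \<in> E"
          using xs(2) by (auto simp: in_set_conv_nth)
        then show "u \<in> (\<lambda>j. ?ys ! j) ` {j. 0 < j \<and> j < length ?ys \<and> {?ys ! 0, ?ys ! j} \<in> E}"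
          by (intro image_eqI[of _ _ "Suc k"]) (auto simp: insert_commute)
      next
        fix u assume "u \<in> (\<lambda>j. ?ys ! j) ` {j. 0 < j \<and> j < length ?ys \<and> {?ys ! 0, ?ys ! j} \<in> E}"
        then show "u \<in> {u \<in> S. {u, v} \<in> E}"
          using xs(2) by (auto simp: insert_commute nth_Cons split: nat.splits)
      qed
    qed
    then show ?thesis using assms(3) 0 by (simp add: odd_deg_def bij_betw_same_card del: nth_Cons_0)
  next
    case (Suc k)
    have "bij_betw Suc {j. k < j \<and> j < length xs \<and> {xs ! k, xs ! j} \<in> E}
        {j. i < j \<and> j < length ?ys \<and> {?ys ! i, ?ys ! j} \<in> E}"
    proof (rule bij_betw_imageI)
      show "Suc ` {j. k < j \<and> j < length xs \<and> {xs ! k, xs ! j} \<in> E} =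
          {j. i < j \<and> j < length ?ys \<and> {?ys ! i, ?ys ! j} \<in> E}"
      proof (intro subset_antisym subsetI)
        fix j assume j: "j \<in> {j. i < j \<and> j < length ?ys \<and> {?ys ! i, ?ys ! j} \<in> E}"
        then obtain l where "j = Suc l" using not0_implies_Suc[of j] by auto
        then show "j \<in> Suc ` {j. k < j \<and> j < length xs \<and> {xs ! k, xs ! j} \<in> E}"
          using j Suc by auto
      qed (use Suc in auto)
    qed simp
    from bij_betw_same_card[OF this] show ?thesis using xs(3)[of k] that Suc by simp
  qed
  then show ?thesis unfolding eliminable_def using xs assms(2)
    by (intro exI[of _ ?ys] conjI allI impI) auto
qed

lemma even_degenerate_iff_eliminable: "even_degenerate n E \<longleftrightarrow> eliminable E {..<n}"
proof -
  have len: "length xs = n" if "distinct xs \<and> set xs = {..<n}" for xs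
    using that distinct_card[of xs] by simp
  show ?thesis unfolding even_degenerate_def eliminable_def
    by (intro iff_exI) (use len in fastforce)
qed

lemma eliminable_built: "built E \<kappa> B \<Longrightarrow> eliminable E B"
proof (induction rule: built.induct)
  case (built_pair x y)
  then show ?case unfolding eliminable_def by (intro exI[of _ "[x, y]"]) simp
qed (simp add: eliminable_insert)

lemma no_loops: "E \<subseteq> all_edges n \<Longrightarrow> {v, v} \<notin> E"
  by (auto simp: all_edges_def doubleton_eq_iff)

lemma eliminable_reach:
  assumes E: "E \<subseteq> all_edges n"
  shows "reach E {..<n} A \<Longrightarrow> eliminable E A \<Longrightarrow> eliminable E {..<n}"
proof (induction rule: reach.induct)
  case (reach_remove v A)
  have "finite A" using reach_subset[OF reach_remove(1)] finite_subset by auto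
  then have "\<not> odd_deg E v A"
    using odd_deg_insert[of A v E v] reach_remove no_loops[OF E, of v] by simp
  then show ?case using reach_remove eliminable_insert by blast
qed

section \<open>Parity of the number of edges along an elimination\<close>

definition odd_edges :: "nat set set \<Rightarrow> nat set \<Rightarrow> bool" where
  "odd_edges E S \<longleftrightarrow> odd (card {e \<in> E. e \<subseteq> S})"

lemma finite_all_edges: "finite (all_edges n)"
  by (rule finite_subset[of _ "Pow {..<n}"]) (auto simp: all_edges_def)

lemma odd_edges_insert:
  assumes E: "E \<subseteq> all_edges n" and S: "finite S" "v \<notin> S"
  shows "odd_edges E (insert v S) \<longleftrightarrow> odd_edges E S \<noteq> odd_deg E v S"
proof -
  let ?X = "{e \<in> E. e \<subseteq> S}" and ?Y = "(\<lambda>u. {u, v}) ` {u \<in> S. {u, v} \<in> E}"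
  have fE: "finite E" using E finite_all_edges finite_subset by blast
  have "inj_on (\<lambda>u. {u, v}) {u \<in> S. {u, v} \<in> E}"
    by (auto simp: inj_on_def doubleton_eq_iff)
  then have c: "card ?Y = card {u \<in> S. {u, v} \<in> E}" by (rule card_image)
  have "{e \<in> E. e \<subseteq> insert v S} = ?X \<union> ?Y"
  proof (intro subset_antisym subsetI)
    fix e assume e: "e \<in> {e \<in> E. e \<subseteq> insert v S}"
    then obtain a b where ab: "e = {a, b}" "a \<noteq> b"
      using E by (auto simp: all_edges_def)
    then consider "a = v" "b \<in> S" | "b = v" "a \<in> S" | "a \<in> S" "b \<in> S" using e by auto
    then show "e \<in> ?X \<union> ?Y"
      by cases (use ab e in \<open>auto simp: insert_commute\<close>)
  qed auto
  moreover have "?X \<inter> ?Y = {}" using S by auto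
  moreover have "odd (card (?X \<union> ?Y)) \<longleftrightarrow> odd (card ?X) \<noteq> odd (card ?Y)"
    using calculation fE S by (intro odd_card_Un_disjoint) auto
  ultimately show ?thesis unfolding odd_edges_def odd_deg_def by (simp only: c)
qed

lemma odd_edges_reach:
  assumes E: "E \<subseteq> all_edges n"
  shows "reach E {..<n} A \<Longrightarrow> odd_edges E A = odd_edges E {..<n}"
proof (induction rule: reach.induct)
  case (reach_remove v A)
  have f: "finite A" using reach_subset[OF reach_remove(1)] finite_subset by auto
  then have "\<not> odd_deg E v A"
    using odd_deg_insert[of A v E v] reach_remove no_loops[OF E, of v] by simp
  then show ?case using reach_remove odd_edges_insert[OF E f, of v] by simp
qed simp

lemma odd_edges_built:
  assumes E: "E \<subseteq> all_edges n"
  shows "built E \<kappa> B \<Longrightarrow> odd_edges E B = \<kappa>"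
proof (induction rule: built.induct)
  case (built_pair x y)
  \<comment> \<open>The pair is assembled by two insertions, starting from the empty set.\<close>
  have "odd_edges E {y} \<longleftrightarrow> odd_edges E {} \<noteq> odd_deg E y {}" by (rule odd_edges_insert[OF E]) auto
  moreover have "{} \<notin> E" using E by (auto simp: all_edges_def)
  then have "{e \<in> E. e \<subseteq> {}} = {}" by auto
  then have "\<not> odd_edges E {}" unfolding odd_edges_def by (simp only: card.empty) simp
  moreover have "\<not> odd_deg E y {}" by (simp add: odd_deg_def)
  moreover have "odd_edges E {x, y} \<longleftrightarrow> odd_edges E {y} \<noteq> odd_deg E x {y}"
    using built_pair by (intro odd_edges_insert[OF E]) auto
  ultimately show ?case using built_pair by (simp add: odd_deg_single insert_commute)
next
  case (built_add B v)
  then show ?case using odd_edges_insert[OF E, of B v] built_finite[OF built_add(1)] by simp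
qed

text \<open>\<open>B\<close> and \<open>insert z B\<close> have equal edge parity: the first by the
  choice of its initial pair, the second because it is reached from the whole graph. So
  \<open>z\<close> is even to \<open>B\<close>, and the two halves join into one order.\<close>

lemma even_degenerate_if_states:
  assumes E: "E \<subseteq> all_edges n" and ne: "states {..<n} (odd_edges E {..<n}) E {z} \<noteq> {}" and z: "z < n"
  shows "even_degenerate n E"
proof -
  obtain B where B: "B \<subseteq> {..<n} - {z}" "built E (odd_edges E {..<n}) B" "reach E {..<n} (insert z B)"
    using ne by (auto simp: states_def)
  have zB: "z \<notin> B" using B by auto
  have "\<not> odd_deg E z B"
    using odd_edges_insert[OF E built_finite[OF B(2)] zB] odd_edges_reach[OF E B(3)] odd_edges_built[OF E B(2)]
    by blast
  then have "eliminable E (insert z B)" using eliminable_insert[OF eliminable_built[OF B(2)] zB] by simp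
  then show ?thesis using eliminable_reach[OF E B(3)] by (simp add: even_degenerate_iff_eliminable)
qed

section \<open>Averaging over edge toggles\<close>

definition toggle :: "nat set set \<Rightarrow> nat set set \<Rightarrow> nat set set" where
  "toggle E F = (E - F) \<union> (F - E)"

text \<open>Toggling both edges from \<open>m\<close> to \<open>v\<close> and to \<open>z\<close> keeps the parity of the degree of \<open>m\<close> into any
  set containing \<open>v\<close> and \<open>z\<close>, but makes the adjacency of \<open>m\<close> and \<open>v\<close> a fresh random bit.\<close>

definition star :: "nat \<Rightarrow> nat \<Rightarrow> nat set \<Rightarrow> nat set set" where
  "star v z y = (\<lambda>m. {m, v}) ` y \<union> (\<lambda>m. {m, z}) ` y"

lemma odd_card_sym_diff:
  assumes "finite A" "finite B"
  shows "odd (card ((A - B) \<union> (B - A))) \<longleftrightarrow> odd (card A) \<noteq> odd (card B)"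
proof -
  have "card A = card (A - B) + card (A \<inter> B)" "card B = card (B - A) + card (A \<inter> B)"
    using assms by (metis card_Un_disjoint Diff_disjoint Int_Diff_Un Un_commute finite_Diff finite_Int
        inf_commute Int_Diff_disjoint)+
  moreover have "card ((A - B) \<union> (B - A)) = card (A - B) + card (B - A)"
    using assms by (intro card_Un_disjoint) auto
  ultimately show ?thesis by auto
qed

lemma odd_deg_toggle:
  assumes "finite S"
  shows "odd_deg (toggle E F) v S \<longleftrightarrow> odd_deg E v S \<noteq> odd_deg F v S"
proof -
  let ?X = "{u \<in> S. {u, v} \<in> E}" and ?Y = "{u \<in> S. {u, v} \<in> F}"
  have "{u \<in> S. {u, v} \<in> toggle E F} = (?X - ?Y) \<union> (?Y - ?X)" by (auto simp: toggle_def)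
  then show ?thesis unfolding odd_deg_def using odd_card_sym_diff[of ?X ?Y] assms by simp
qed

lemma mem_toggle: "e \<in> toggle E F \<longleftrightarrow> (e \<in> E) \<noteq> (e \<in> F)"
  by (auto simp: toggle_def)

lemma toggle_toggle: "toggle (toggle E F) F = E"
  by (auto simp: toggle_def)

lemma finite_graphs: "finite (graphs n)"
  by (simp add: graphs_def finite_all_edges)

text \<open>Toggling a fixed set of edges is an involution on the graphs, so each \<open>y\<close>
  contributes the full sum.\<close>

lemma sum_toggle:
  fixes h :: "nat set set \<Rightarrow> real"
  assumes "\<And>y. y \<in> Y \<Longrightarrow> F y \<subseteq> all_edges n"
  shows "(\<Sum>E\<in>graphs n. \<Sum>y\<in>Y. h (toggle E (F y))) = real (card Y) * (\<Sum>E\<in>graphs n. h E)"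
proof -
  have "(\<Sum>E\<in>graphs n. h (toggle E (F y))) = (\<Sum>E\<in>graphs n. h E)" if "y \<in> Y" for y
    by (rule sum.reindex_bij_witness[of _ "\<lambda>E. toggle E (F y)" "\<lambda>E. toggle E (F y)"])
      (use assms[OF that] in \<open>auto simp: toggle_toggle graphs_def toggle_def\<close>)
  then show ?thesis by (subst sum.swap) simp
qed

text \<open>This replaces conditional expectation: toggling by a random \<open>F y\<close> preserves
  the uniform distribution, so bounding the average over \<open>y\<close> for each single graph
  bounds the average over all graphs.\<close>

lemma sum_le_by_toggle:
  fixes h g :: "nat set set \<Rightarrow> real"
  assumes "\<And>y. y \<in> Y \<Longrightarrow> F y \<subseteq> all_edges n" "finite Y" "Y \<noteq> {}"
    and "\<And>E. E \<in> graphs n \<Longrightarrow> (\<Sum>y\<in>Y. h (toggle E (F y))) \<le> g E * real (card Y)"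
  shows "(\<Sum>E\<in>graphs n. h E) \<le> (\<Sum>E\<in>graphs n. g E)"
proof -
  have "real (card Y) * (\<Sum>E\<in>graphs n. h E) = (\<Sum>E\<in>graphs n. \<Sum>y\<in>Y. h (toggle E (F y)))"
    using sum_toggle[of Y F n h, OF assms(1)] by simp
  also have "\<dots> \<le> (\<Sum>E\<in>graphs n. g E * real (card Y))"
    by (rule sum_mono) (rule assms(4))
  also have "\<dots> = real (card Y) * (\<Sum>E\<in>graphs n. g E)"
    by (simp add: sum_distrib_left mult.commute)
  finally show ?thesis using assms(2,3) by (simp add: card_gt_0_iff)
qed

lemma mem_star:
  assumes "y \<subseteq> M" "v \<notin> M" "z \<notin> M" "m \<in> M"
  shows "{u, m} \<in> star v z y \<longleftrightarrow> m \<in> y \<and> (u = v \<or> u = z)"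
  using assms unfolding star_def by (auto simp: doubleton_eq_iff)

text \<open>A vertex \<open>m \<in> y\<close> has exactly two star edges, to \<open>v\<close> and to
  \<open>z\<close>, which cancel in sets containing both or neither. The set \<open>b\<close> allows
  for further toggled edges avoiding \<open>M\<close>.\<close>

lemma odd_deg_star_M:
  assumes "y \<subseteq> M" "v \<notin> M" "z \<notin> M" "v \<noteq> z" "m \<in> M" "\<And>e. e \<in> b \<Longrightarrow> e \<inter> M = {}"
  shows "odd_deg (star v z y \<union> b) m S \<longleftrightarrow> m \<in> y \<and> (v \<in> S) \<noteq> (z \<in> S)"
proof -
  have "{u, m} \<in> star v z y \<union> b \<longleftrightarrow> m \<in> y \<and> (u = v \<or> u = z)" for u
    using mem_star[OF assms(1-3,5)] assms(5) assms(6)[of "{u, m}"] by auto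
  then have "{u \<in> S. {u, m} \<in> star v z y \<union> b} = (if m \<in> y then S \<inter> {v, z} else {})" by auto
  moreover have "odd (card (S \<inter> {v, z})) \<longleftrightarrow> (v \<in> S) \<noteq> (z \<in> S)"
    using assms(4) by (cases "v \<in> S"; cases "z \<in> S") auto
  ultimately show ?thesis by (simp add: odd_deg_def)
qed

text \<open>Inside \<open>M\<close> the star edges at \<open>v\<close> lead exactly to
  \<open>y\<close>; for uniform \<open>y\<close> and nonempty \<open>S\<close> this parity is a fair
  bit.\<close>

lemma odd_deg_star_v:
  assumes "y \<subseteq> M" "v \<notin> M" "z \<notin> M" "v \<noteq> z" "S \<subseteq> M" "\<And>e. e \<in> b \<Longrightarrow> e \<inter> M = {}"
  shows "odd_deg (star v z y \<union> b) v S \<longleftrightarrow> odd (card (S \<inter> y))"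
proof -
  have "{u, v} \<in> star v z y \<union> b \<longleftrightarrow> u \<in> y" if "u \<in> S" for u
    using mem_star[OF assms(1-3), of u v] that assms(5) assms(6)[of "{u, v}"]
    by (auto simp: insert_commute)
  then have "{u \<in> S. {u, v} \<in> star v z y \<union> b} = S \<inter> y" by auto
  then show ?thesis by (simp add: odd_deg_def)
qed

text \<open>Both star centres lie outside \<open>M\<close>, so the changes cancel in every parity
  into \<open>V - M\<close>: nothing already exposed is altered.\<close>

lemma agree_toggle:
  assumes "finite V" "v \<in> V - M" "z \<in> V - M" "v \<noteq> z" "y \<subseteq> M" "\<And>e. e \<in> b \<Longrightarrow> e \<inter> M = {}"
  shows "agree V M E (toggle E (star v z y \<union> b))"
  unfolding agree_def
proof (intro conjI ballI)
  fix m m' assume m: "m \<in> M" "m' \<in> M"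
  have "{m, m'} \<notin> star v z y \<union> b"
    using mem_star[OF assms(5), of v z m' m] m assms(2,3) assms(6)[of "{m, m'}"] by auto
  then show "({m, m'} \<in> E) = ({m, m'} \<in> toggle E (star v z y \<union> b))" by (simp add: mem_toggle)
next
  fix m assume m: "m \<in> M"
  have "\<not> odd_deg (star v z y \<union> b) m (V - M)"
    using assms(2,3) by (subst odd_deg_star_M[OF assms(5) _ _ assms(4) m assms(6)]) auto
  then show "odd_deg E m (V - M) = odd_deg (toggle E (star v z y \<union> b)) m (V - M)"
    using odd_deg_toggle[of "V - M" E "star v z y \<union> b" m] assms(1) by simp
qed

section \<open>Walsh characters \<open>chi\<close>, and moments of their signed sums\<close>

definition chi :: "nat set \<Rightarrow> nat set \<Rightarrow> real" where
  "chi y B = (if odd (card (B \<inter> y)) then -1 else 1)"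

lemma chi_mult:
  assumes "finite B" "finite C"
  shows "chi y B * chi y C = chi y ((B - C) \<union> (C - B))"
proof -
  have "((B - C) \<union> (C - B)) \<inter> y = (B \<inter> y - C \<inter> y) \<union> (C \<inter> y - B \<inter> y)" by auto
  then show ?thesis using odd_card_sym_diff[of "B \<inter> y" "C \<inter> y"] assms by (auto simp: chi_def)
qed

text \<open>Toggling one element of \<open>B\<close> in \<open>y\<close> pairs off summands of
  opposite sign.\<close>

lemma sum_chi:
  assumes "finite M" "B \<subseteq> M" "B \<noteq> {}"
  shows "(\<Sum>y\<in>Pow M. chi y B) = 0"
proof -
  obtain m where m: "m \<in> B" using assms by auto
  define f where "f = (\<lambda>y. (y - {m}) \<union> ({m} - y))"
  have fin: "finite y" if "y \<in> Pow M" for y using that assms(1) finite_subset by auto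
  have ff: "f (f y) = y" for y by (auto simp: f_def)
  have "(\<Sum>y\<in>Pow M. chi y B) = (\<Sum>y\<in>Pow M. chi (f y) B)"
  proof (rule sum.reindex_bij_witness[of _ f f])
    show "f y \<in> Pow M" "f y \<in> Pow M" if "y \<in> Pow M" for y
      using that m assms(2) by (auto simp: f_def)
  qed (simp_all only: ff)
  also have "\<dots> = (\<Sum>y\<in>Pow M. - chi y B)"
  proof (rule sum.cong[OF refl])
    fix y assume y: "y \<in> Pow M"
    have "B \<inter> f y = (B \<inter> y - {m}) \<union> ({m} - B \<inter> y)" using m by (auto simp: f_def)
    then show "chi (f y) B = - chi y B"
      using odd_card_sym_diff[of "B \<inter> y" "{m}"] fin[OF y] by (auto simp: chi_def)
  qed
  finally show ?thesis by (simp add: sum_negf)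
qed

text \<open>Characters of distinct sets are orthogonal, so only the diagonal survives. This is the
  variance computation behind pairwise independence.\<close>

lemma sum_chi_sq:
  assumes M: "finite M" and S: "S \<subseteq> Pow M" and s: "\<And>B. B \<in> S \<Longrightarrow> s B * s B = 1"
  shows "(\<Sum>y\<in>Pow M. (\<Sum>B\<in>S. s B * chi y B)\<^sup>2) = real (card S) * 2 ^ card M"
proof -
  have fS: "finite S" using S M by (meson finite_Pow_iff finite_subset)
  have "(\<Sum>y\<in>Pow M. (\<Sum>B\<in>S. s B * chi y B)\<^sup>2)
      = (\<Sum>y\<in>Pow M. \<Sum>B\<in>S. \<Sum>C\<in>S. s B * s C * (chi y B * chi y C))"
    by (simp add: power2_eq_square sum_product mult_ac)
  also have "\<dots> = (\<Sum>B\<in>S. \<Sum>C\<in>S. s B * s C * (\<Sum>y\<in>Pow M. chi y B * chi y C))"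
    by (subst sum.swap, rule sum.cong[OF refl], subst sum.swap) (simp add: sum_distrib_left)
  also have "\<dots> = (\<Sum>B\<in>S. \<Sum>C\<in>S. if B = C then 2 ^ card M else 0)"
  proof (intro sum.cong refl)
    fix B C assume BC: "B \<in> S" "C \<in> S"
    then have sub: "B \<subseteq> M" "C \<subseteq> M" using S by auto
    then have f: "finite B" "finite C" using M finite_subset by auto
    show "s B * s C * (\<Sum>y\<in>Pow M. chi y B * chi y C) = (if B = C then 2 ^ card M else 0)"
    proof (cases "B = C")
      case True
      have "chi y B * chi y B = 1" for y by (simp add: chi_def)
      then show ?thesis using True s BC M by (simp add: card_Pow)
    next
      case False
      then have "(\<Sum>y\<in>Pow M. chi y B * chi y C) = 0"
        unfolding chi_mult[OF f] using sub M by (intro sum_chi) auto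
      then show ?thesis using False by simp
    qed
  qed
  also have "\<dots> = real (card S) * 2 ^ card M" using fS by simp
  finally show ?thesis .
qed

text \<open>\<open>d\<close> holds the parities before the toggle and \<open>chi\<close> the sign
  change caused by it, so each even set counts \<open>1\<close> and each odd set
  \<open>-1\<close>.\<close>

lemma card_even_chi:
  fixes S :: "nat set set"
  assumes "finite S" "\<And>B. B \<in> S \<Longrightarrow> P B \<longleftrightarrow> d B \<noteq> odd (card (B \<inter> y))"
  shows "2 * real (card {B \<in> S. \<not> P B}) = real (card S) + (\<Sum>B\<in>S. (if d B then -1 else 1) * chi y B)"
proof -
  have "(\<Sum>B\<in>S. (if d B then -1 else 1) * chi y B) = (\<Sum>B\<in>S. 2 * (if \<not> P B then 1 else 0) - 1)"
    using assms(2) by (intro sum.cong refl) (auto simp: chi_def)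
  also have "\<dots> = 2 * (\<Sum>B\<in>S. if \<not> P B then 1 else 0) - real (card S)"
    by (simp add: sum_subtractf sum_distrib_left)
  also have "(\<Sum>B\<in>S. if \<not> P B then 1 else 0 :: real) = real (card {B \<in> S. \<not> P B})"
    using assms(1) by (simp add: sum.If_cases Int_def conj_commute)
  finally show ?thesis by simp
qed

text \<open>First moment argument: the signed sum \<open>D\<close> has mean zero because all sets
  are nonempty. It is at most \<open>card S\<close> everywhere and at most
  \<open>- card S / 2\<close> on bad choices, so good choices are at least half as many as bad
  ones.\<close>

lemma many_even:
  fixes M :: "nat set"
  assumes M: "finite M" and S: "S \<subseteq> Pow M" "{} \<notin> S"
    and P: "\<And>y B. y \<subseteq> M \<Longrightarrow> B \<in> S \<Longrightarrow> P y B \<longleftrightarrow> d B \<noteq> odd (card (B \<inter> y))"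
  shows "2 ^ card M \<le> 3 * card {y \<in> Pow M. card S \<le> 4 * card {B \<in> S. \<not> P y B}}"
proof (cases "S = {}")
  case True
  then show ?thesis using M by (simp add: card_Pow flip: Pow_def)
next
  case False
  have fS: "finite S" using S M by (meson finite_Pow_iff finite_subset)
  define D where "D = (\<lambda>y. \<Sum>B\<in>S. (if d B then -1 else 1) * chi y B)"
  have D: "2 * real (card {B \<in> S. \<not> P y B}) = real (card S) + D y" if "y \<in> Pow M" for y
    unfolding D_def using that P by (intro card_even_chi fS) auto
  have sD: "(\<Sum>y\<in>Pow M. D y) = 0"
    unfolding D_def
  proof (subst sum.swap, rule sum.neutral, rule ballI)
    fix B assume "B \<in> S"
    then show "(\<Sum>y\<in>Pow M. (if d B then -1 else 1) * chi y B) = 0"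
      using sum_chi[OF M, of B] S by (auto simp flip: sum_distrib_left)
  qed
  define G where "G = {y \<in> Pow M. card S \<le> 4 * card {B \<in> S. \<not> P y B}}"
  have GM: "G \<subseteq> Pow M" and fG: "finite G" using M by (auto simp: G_def)
  have up: "D y \<le> card S" if "y \<in> G" for y
  proof -
    have "card {B \<in> S. \<not> P y B} \<le> card S" using fS by (intro card_mono) auto
    then show ?thesis using D[of y] that GM by auto
  qed
  have lo: "D y \<le> - (card S / 2)" if "y \<in> Pow M - G" for y
  proof -
    have "4 * card {B \<in> S. \<not> P y B} < card S" using that by (auto simp: G_def)
    then have "4 * real (card {B \<in> S. \<not> P y B}) < real (card S)"
      by (metis of_nat_less_iff of_nat_mult of_nat_numeral)
    then show ?thesis using D[of y] that by auto
  qed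
  have "0 = (\<Sum>y\<in>G. D y) + (\<Sum>y\<in>Pow M - G. D y)"
    using sD GM M by (metis add.commute finite_Pow_iff sum.subset_diff)
  also have "\<dots> \<le> (\<Sum>y\<in>G. real (card S)) + (\<Sum>y\<in>Pow M - G. - (card S / 2))"
    using up lo by (intro add_mono sum_mono) auto
  also have "\<dots> = real (card S) * (real (card G) - real (card (Pow M - G)) / 2)"
    by (simp add: algebra_simps)
  finally have "0 \<le> real (card G) - real (card (Pow M - G)) / 2"
    using False fS by (simp add: zero_le_mult_iff)
  moreover have "card (Pow M) = card G + card (Pow M - G)"
    using GM M by (metis card_Diff_subset card_mono fG finite_Pow_iff le_add_diff_inverse)
  ultimately show ?thesis unfolding G_def[symmetric] using M by (simp add: card_Pow)
qed

text \<open>Chebyshev: on the bad choices the signed sum is below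
  \<open>- \<delta> * card S\<close>, while its mean square is \<open>card S\<close>.\<close>

lemma rarely_few_even:
  fixes \<delta> :: real and M :: "nat set"
  assumes M: "finite M" and S: "S \<subseteq> Pow M" and \<delta>: "0 < \<delta>"
    and P: "\<And>y B. y \<subseteq> M \<Longrightarrow> B \<in> S \<Longrightarrow> P y B \<longleftrightarrow> d B \<noteq> odd (card (B \<inter> y))"
  shows "\<delta>\<^sup>2 * real (card S) * real (card {y \<in> Pow M. 2 * real (card {B \<in> S. \<not> P y B}) < (1 - \<delta>) * real (card S)})
    \<le> 2 ^ card M"
proof (cases "S = {}")
  case False
  have fS: "finite S" using S M by (meson finite_Pow_iff finite_subset)
  define N where "N = real (card S)"
  have N: "N > 0" using False fS by (simp add: N_def card_gt_0_iff)
  define D where "D = (\<lambda>y. \<Sum>B\<in>S. (if d B then -1 else 1) * chi y B)"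
  define G where "G = {y \<in> Pow M. 2 * real (card {B \<in> S. \<not> P y B}) < (1 - \<delta>) * N}"
  have GM: "G \<subseteq> Pow M" by (auto simp: G_def)
  have D: "2 * real (card {B \<in> S. \<not> P y B}) = N + D y" if "y \<in> Pow M" for y
    unfolding D_def N_def using that P by (intro card_even_chi fS) auto
  have big: "(\<delta> * N)\<^sup>2 \<le> (D y)\<^sup>2" if "y \<in> G" for y
  proof -
    have "\<delta> * N \<le> - D y" using D[of y] that by (auto simp: G_def algebra_simps)
    then have "(\<delta> * N)\<^sup>2 \<le> (- D y)\<^sup>2" using \<delta> N by (intro power_mono) auto
    then show ?thesis by simp
  qed
  have "real (card G) * (\<delta> * N)\<^sup>2 \<le> (\<Sum>y\<in>G. (D y)\<^sup>2)"
    using sum_mono[of G "\<lambda>_. (\<delta> * N)\<^sup>2" "\<lambda>y. (D y)\<^sup>2"] big by simp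
  also have "\<dots> \<le> (\<Sum>y\<in>Pow M. (D y)\<^sup>2)" using GM M by (intro sum_mono2) auto
  also have "\<dots> = N * 2 ^ card M" unfolding D_def N_def by (intro sum_chi_sq M S) simp
  finally have "N * (\<delta>\<^sup>2 * N * real (card G)) \<le> N * 2 ^ card M"
    by (simp add: power2_eq_square mult_ac)
  then show ?thesis using N by (simp add: G_def N_def)
qed simp

lemma agree_states_superset:
  assumes "finite V" "agree V M E E'" "V - M \<subseteq> U" "U \<subseteq> V"
  shows "states V \<kappa> E U = states V \<kappa> E' U"
proof (rule agree_states[OF assms(1) _ assms(4)])
  show "agree V (V - U) E E'" by (rule agree_antimono[OF assms(1,2)]) (use assms(3) in auto)
qed

section \<open>Phase 1: making the number of states exponentially large\<close>

definition nstates :: "nat \<Rightarrow> bool \<Rightarrow> nat set set \<Rightarrow> nat set \<Rightarrow> nat" where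
  "nstates n \<kappa> E U = card (states {..<n} \<kappa> E U)"

text \<open>The test \<open>1 \<le>\<close> matters at the start: the full vertex set has no states,
  since built sets are nonempty, so the growth test alone would accept a pair that yields
  none.\<close>

primrec phase1 :: "nat \<Rightarrow> bool \<Rightarrow> nat set set \<Rightarrow> nat \<Rightarrow> nat set" where
  "phase1 n \<kappa> E 0 = {..<n}"
| "phase1 n \<kappa> E (Suc j) =
     (let U = phase1 n \<kappa> E j; U' = U - {2 * j, 2 * j + 1} in
      if 1 \<le> nstates n \<kappa> E U' \<and> 5 * nstates n \<kappa> E U \<le> 4 * nstates n \<kappa> E U' then U' else U)"

lemma phase1_subset: "phase1 n \<kappa> E j \<subseteq> {..<n}"
  by (induction j) (auto simp: Let_def)

lemma phase1_superset: "{2 * j..<n} \<subseteq> phase1 n \<kappa> E j"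
proof (induction j)
  case (Suc j)
  have "{2 * Suc j..<n} \<subseteq> phase1 n \<kappa> E j - {2 * j, 2 * j + 1}" using Suc by auto
  then show ?case by (auto simp: Let_def)
qed auto

text \<open>The first \<open>j\<close> rounds count states only for sets containing all vertices
  from \<open>2 * j\<close> on, and such counts depend only on the exposed information.\<close>

lemma agree_phase1:
  "agree {..<n} {..<2 * j} E E' \<Longrightarrow> phase1 n \<kappa> E j = phase1 n \<kappa> E' j"
proof (induction j)
  case (Suc j)
  let ?U = "phase1 n \<kappa> E j"
  have "agree {..<n} {..<2 * j} E E'" by (rule agree_antimono[OF _ Suc(2)]) auto
  then have U: "phase1 n \<kappa> E' j = ?U" using Suc(1) by simp
  have sub: "{..<n} - {..<2 * Suc j} \<subseteq> ?U - {2 * j, 2 * j + 1}"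
    using phase1_superset[of j n \<kappa> E] by auto
  have eq: "nstates n \<kappa> E W = nstates n \<kappa> E' W" if "{..<n} - {..<2 * Suc j} \<subseteq> W" "W \<subseteq> {..<n}" for W
    unfolding nstates_def by (subst agree_states_superset[OF _ Suc(2) that]) auto
  have "nstates n \<kappa> E ?U = nstates n \<kappa> E' ?U"
    using sub phase1_subset[of n \<kappa> E j] by (intro eq) auto
  moreover have "nstates n \<kappa> E (?U - {2 * j, 2 * j + 1}) = nstates n \<kappa> E' (?U - {2 * j, 2 * j + 1})"
    using sub phase1_subset[of n \<kappa> E j] by (intro eq) auto
  ultimately show ?case using U by (simp only: phase1.simps Let_def)
qed simp

lemma phase1_pair_mem:
  assumes "2 * j + 1 < n"
  shows "2 * j \<in> phase1 n \<kappa> E j" "2 * j + 1 \<in> phase1 n \<kappa> E j"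
  using phase1_superset[of j n \<kappa> E] assms by auto

lemma card_phase1_accept:
  assumes "2 * j + 1 < n"
  shows "n - card (phase1 n \<kappa> E j - {2 * j, 2 * j + 1}) = n - card (phase1 n \<kappa> E j) + 2"
proof -
  let ?U = "phase1 n \<kappa> E j"
  have f: "finite ?U" by (rule finite_subset[OF phase1_subset]) simp
  have "{2 * j, 2 * j + 1} \<subseteq> ?U" using phase1_pair_mem[OF assms] by auto
  moreover have "card {2 * j, 2 * j + 1} = 2" by simp
  ultimately have "card (?U - {2 * j, 2 * j + 1}) = card ?U - 2" "2 \<le> card ?U"
    using f by (metis card_Diff_subset finite.emptyI finite.insertI, metis card_mono)
  moreover have "card ?U \<le> n" using card_mono[OF _ phase1_subset[of n \<kappa> E j]] by simp
  ultimately show ?thesis by simp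
qed

text \<open>Each accepted pair gains \<open>5 / 4\<close>, more than
  \<open>(11 / 10)\<^sup>2\<close>. The factor \<open>2\<close> pays for the first accepted pair,
  which guarantees just one state.\<close>

lemma phase1_many_states:
  assumes "2 * j < n" "phase1 n \<kappa> E j \<noteq> {..<n}"
  shows "1 \<le> nstates n \<kappa> E (phase1 n \<kappa> E j) \<and>
    (11 / 10) ^ (n - card (phase1 n \<kappa> E j)) \<le> 2 * real (nstates n \<kappa> E (phase1 n \<kappa> E j))"
  using assms
proof (induction j)
  case (Suc j)
  let ?U = "phase1 n \<kappa> E j"
  let ?U' = "?U - {2 * j, 2 * j + 1}"
  show ?case
  proof (cases "1 \<le> nstates n \<kappa> E ?U' \<and> 5 * nstates n \<kappa> E ?U \<le> 4 * nstates n \<kappa> E ?U'")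
    case False
    then have eq: "phase1 n \<kappa> E (Suc j) = ?U" by (simp only: phase1.simps Let_def if_False)
    have "2 * j < n" "?U \<noteq> {..<n}" using Suc.prems unfolding eq by simp_all
    then show ?thesis unfolding eq by (rule Suc.IH)
  next
    case True
    then have eq: "phase1 n \<kappa> E (Suc j) = ?U'" by (simp add: Let_def)
    have T: "5 * real (nstates n \<kappa> E ?U) \<le> 4 * real (nstates n \<kappa> E ?U')"
      "1 \<le> real (nstates n \<kappa> E ?U')"
      using True by linarith+
    have c: "n - card ?U' = n - card ?U + 2" using card_phase1_accept Suc.prems(1) by simp
    have "(11 / 10) ^ (n - card ?U') \<le> 2 * real (nstates n \<kappa> E ?U')"
    proof (cases "?U = {..<n}")
      case full: True
      have "n - card ?U' = 2" using c full by simp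
      then show ?thesis using T(2) by (simp add: power2_eq_square)
    next
      case F: False
      then have "(11 / 10) ^ (n - card ?U) \<le> 2 * real (nstates n \<kappa> E ?U)"
        using Suc by simp
      moreover have "(11 / 10 :: real) ^ (n - card ?U') = 121 / 100 * (11 / 10) ^ (n - card ?U)"
        unfolding c by (simp add: power_add power2_eq_square)
      ultimately show ?thesis using T by linarith
    qed
    then show ?thesis unfolding eq using True by simp
  qed
qed simp

lemma all_edgesI: "u < v \<Longrightarrow> v < n \<Longrightarrow> {u, v} \<in> all_edges n"
  by (auto simp: all_edges_def)

lemma star_subset:
  assumes "y \<subseteq> {..<v}" "v < z" "z < n"
  shows "star v z y \<subseteq> all_edges n"
proof
  fix e assume "e \<in> star v z y"
  then obtain m where m: "m \<in> y" "e = {m, v} \<or> e = {m, z}" by (auto simp: star_def)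
  have "m < v" using m assms by auto
  then show "e \<in> all_edges n" using m(2) assms(2,3) by (auto intro: all_edgesI)
qed

lemma toggle_Un: "F \<inter> b = {} \<Longrightarrow> toggle E (F \<union> b) = toggle (toggle E F) b"
  by (auto simp: toggle_def)

text \<open>First settle the edge \<open>vw\<close>; then \<open>vz\<close> and \<open>wz\<close>
  correct the parities of \<open>v\<close> and \<open>w\<close> independently, with \<open>z\<close>
  absorbing the changes.\<close>

lemma triangle_adjust:
  assumes "v \<noteq> w" "v \<noteq> z" "w \<noteq> z" "v \<in> U" "w \<in> U" "z \<in> U" "finite U"
  obtains b where "b \<subseteq> {{v, w}, {v, z}, {w, z}}" "{v, w} \<in> toggle E b"
    "\<not> odd_deg (toggle E b) v U" "odd_deg (toggle E b) w U"
proof -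
  define \<beta>1 where "\<beta>1 \<longleftrightarrow> {v, w} \<notin> E"
  define \<beta>2 where "\<beta>2 \<longleftrightarrow> \<beta>1 \<noteq> odd_deg E v U"
  define \<beta>3 where "\<beta>3 \<longleftrightarrow> \<beta>1 \<noteq> (\<not> odd_deg E w U)"
  define b where "b = {e. e = {v, w} \<and> \<beta>1 \<or> e = {v, z} \<and> \<beta>2 \<or> e = {w, z} \<and> \<beta>3}"
  have "{u \<in> U. {u, v} \<in> b} = (if \<beta>1 then {w} else {}) \<union> (if \<beta>2 then {z} else {})"
    using assms by (auto simp: b_def doubleton_eq_iff)
  then have bv: "odd_deg b v U \<longleftrightarrow> \<beta>1 \<noteq> \<beta>2" using assms(3) by (auto simp: odd_deg_def)
  have "{u \<in> U. {u, w} \<in> b} = (if \<beta>1 then {v} else {}) \<union> (if \<beta>3 then {z} else {})"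
    using assms by (auto simp: b_def doubleton_eq_iff)
  then have bw: "odd_deg b w U \<longleftrightarrow> \<beta>1 \<noteq> \<beta>3" using assms(2) by (auto simp: odd_deg_def)
  have "{v, w} \<in> b \<longleftrightarrow> \<beta>1" using assms by (auto simp: b_def doubleton_eq_iff)
  then have "{v, w} \<in> toggle E b" by (auto simp: mem_toggle \<beta>1_def)
  moreover have "\<not> odd_deg (toggle E b) v U" "odd_deg (toggle E b) w U"
    using bv bw by (auto simp: odd_deg_toggle[OF assms(7)] \<beta>2_def \<beta>3_def)
  moreover have "b \<subseteq> {{v, w}, {v, z}, {w, z}}" by (auto simp: b_def)
  ultimately show ?thesis using that by blast
qed

text \<open>A third of the choices \<open>y\<close> are good, and for each of them at least one of
  the eight toggles of the triangle on the new pair and \<open>n - 1\<close> leads to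
  acceptance.\<close>

lemma phase1_accept:
  assumes j: "2 * j + 2 < n" and U: "U = phase1 n \<kappa> E j"
  defines "ex \<equiv> {{2 * j, 2 * j + 1}, {2 * j, n - 1}, {2 * j + 1, n - 1}}"
  obtains G where "G \<subseteq> Pow {..<2 * j}" "2 ^ (2 * j) \<le> 3 * card G"
    "\<And>y. y \<in> G \<Longrightarrow> \<exists>b\<in>Pow ex.
       phase1 n \<kappa> (toggle E (star (2 * j) (n - 1) y \<union> b)) (Suc j) = U - {2 * j, 2 * j + 1}"
proof -
  define v w z M V where "v = 2 * j" and "w = 2 * j + 1" and "z = n - 1"
    and "M = {..<2 * j}" and "V = {..<n}"
  have neq: "v \<noteq> w" "v \<noteq> z" "w \<noteq> z" and nM: "v \<notin> M" "w \<notin> M" "z \<notin> M"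
    using j by (auto simp: v_def w_def z_def M_def)
  have mem: "v \<in> U" "w \<in> U" "z \<in> U" "U \<subseteq> V" "V - M \<subseteq> U"
    using phase1_superset[of j n \<kappa> E] phase1_subset[of n \<kappa> E j] j
    by (auto simp: v_def w_def z_def U V_def M_def)
  have fV: "finite V" "finite U" using mem by (auto simp: V_def finite_subset)
  have exM: "e \<inter> M = {}" if "e \<in> ex" for e using that nM unfolding ex_def v_def w_def z_def by auto
  have ag: "agree V M E (toggle E (star v z y \<union> b))" if "y \<subseteq> M" "b \<subseteq> ex" for y b
  proof (rule agree_toggle[OF fV(1)])
    show "e \<inter> M = {}" if "e \<in> b" for e using exM[of e] that \<open>b \<subseteq> ex\<close> by blast
  qed (use mem nM neq that in auto)
  have ph: "phase1 n \<kappa> (toggle E (star v z y \<union> b)) j = U" if "y \<subseteq> M" "b \<subseteq> ex" for y b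
    using agree_phase1[of n j E "toggle E (star v z y \<union> b)" \<kappa>] ag[OF that] by (simp add: U V_def M_def)
  have acc: "phase1 n \<kappa> (toggle E (star v z y \<union> b)) (Suc j) = U - {v, w}"
    if "y \<subseteq> M" "b \<subseteq> ex" "1 \<le> nstates n \<kappa> (toggle E (star v z y \<union> b)) (U - {v, w})"
      "5 * nstates n \<kappa> (toggle E (star v z y \<union> b)) U \<le> 4 * nstates n \<kappa> (toggle E (star v z y \<union> b)) (U - {v, w})"
    for y b
    using ph[OF that(1,2)] that(3,4) by (simp add: Let_def v_def w_def)
  show ?thesis
  proof (cases "U = V")
    \<comment> \<open>Nothing has been accepted and there are no states yet, so it suffices that
      \<open>{v, w}\<close> itself becomes one; toggling at most the edge \<open>vw\<close> achieves
      this for every \<open>y\<close>.\<close>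
    case full: True
    have "\<exists>b\<in>Pow ex. phase1 n \<kappa> (toggle E (star v z y \<union> b)) (Suc j) = U - {v, w}" if y: "y \<subseteq> M" for y
    proof -
      define b where "b = (if ({v, w} \<in> E) = \<kappa> then {} else {{v, w}})"
      let ?E = "toggle E (star v z y \<union> b)"
      have bex: "b \<subseteq> ex" by (auto simp: b_def ex_def v_def w_def)
      have "{v, w} \<notin> star v z y" using y nM neq by (auto simp: star_def doubleton_eq_iff)
      then have "({v, w} \<in> ?E) = \<kappa>" by (auto simp: mem_toggle b_def)
      then have "built ?E \<kappa> {v, w}" using neq(1) by (intro built_pair)
      moreover have "{v, w} \<union> (U - {v, w}) = V" using mem full by auto
      ultimately have "{v, w} \<in> states V \<kappa> ?E (U - {v, w})"
        using mem by (auto simp: states_def reach_refl)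
      then have "1 \<le> nstates n \<kappa> ?E (U - {v, w})"
        using finite_states[OF fV(1), of \<kappa> ?E "U - {v, w}"]
        by (auto simp: nstates_def V_def Suc_le_eq card_gt_0_iff)
      moreover have "states V \<kappa> ?E U = {}" using full by (auto simp: states_def dest: built_nonempty)
      then have "nstates n \<kappa> ?E U = 0" by (simp add: nstates_def V_def)
      ultimately show ?thesis using acc[OF y bex] bex by auto
    qed
    then show ?thesis using that[of "Pow M"]
      by (simp add: card_Pow M_def v_def w_def z_def)
  next
    case False
    define S where "S = states V \<kappa> E U"
    have SE: "states V \<kappa> (toggle E (star v z y \<union> b)) U = S" if "y \<subseteq> M" "b \<subseteq> ex" for y b
      using agree_states_superset[OF fV(1) ag[OF that] mem(5,4)] by (simp add: S_def)
    have SM: "S \<subseteq> Pow M" using mem(5) by (auto simp: S_def states_def)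
    have S0: "{} \<notin> S" by (auto simp: S_def states_def dest: built_nonempty)
    have S1: "1 \<le> card S"
      using phase1_many_states[of j n \<kappa> E] j False by (simp add: U V_def S_def nstates_def)
    \<comment> \<open>These choices leave \<open>v\<close> even to at least a quarter of the states,
      so the pair step gives \<open>5 / 4\<close> times as many.\<close>
    define G where "G = {y \<in> Pow M. card S \<le> 4 * card {B \<in> S. \<not> (odd_deg E v B \<noteq> odd (card (B \<inter> y)))}}"
    have "2 ^ card M \<le> 3 * card G" unfolding G_def
      by (rule many_even[where d = "odd_deg E v"]) (use SM S0 in \<open>auto simp: M_def\<close>)
    moreover have "\<exists>b\<in>Pow ex. phase1 n \<kappa> (toggle E (star v z y \<union> b)) (Suc j) = U - {v, w}"
      if yG: "y \<in> G" for y
    proof -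
      have y: "y \<subseteq> M" using yG by (auto simp: G_def)
      obtain b where b: "b \<subseteq> {{v, w}, {v, z}, {w, z}}" "{v, w} \<in> toggle (toggle E (star v z y)) b"
        "\<not> odd_deg (toggle (toggle E (star v z y)) b) v U" "odd_deg (toggle (toggle E (star v z y)) b) w U"
        using triangle_adjust[OF neq mem(1-3) fV(2)] by blast
      have bex: "b \<subseteq> ex" using b(1) by (simp add: ex_def v_def w_def z_def)
      let ?E = "toggle E (star v z y \<union> b)"
      have "star v z y \<inter> b = {}"
      proof -
        have "e \<inter> M \<noteq> {}" if "e \<in> star v z y" for e using that y by (auto simp: star_def)
        then show ?thesis using exM bex by blast
      qed
      then have E: "?E = toggle (toggle E (star v z y)) b" by (rule toggle_Un)
      have "card (states V \<kappa> ?E U) + card {B \<in> states V \<kappa> ?E U. \<not> odd_deg ?E v B} \<le> card (states V \<kappa> ?E (U - {v, w}))"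
        using b(2-4) unfolding E[symmetric] by (intro card_states_remove_pair fV mem neq) auto
      moreover have "odd_deg ?E v B \<longleftrightarrow> odd_deg E v B \<noteq> odd (card (B \<inter> y))" if "B \<in> S" for B
      proof -
        have B: "B \<subseteq> M" "finite B" using that SM by (auto simp: M_def finite_subset)
        have "odd_deg (star v z y \<union> b) v B \<longleftrightarrow> odd (card (B \<inter> y))"
          by (rule odd_deg_star_v[OF y nM(1,3) neq(2) B(1)]) (use bex exM in auto)
        then show ?thesis using odd_deg_toggle[OF B(2)] by simp
      qed
      then have "{B \<in> S. \<not> odd_deg ?E v B} = {B \<in> S. \<not> (odd_deg E v B \<noteq> odd (card (B \<inter> y)))}" by auto
      ultimately have "card S + card {B \<in> S. \<not> (odd_deg E v B \<noteq> odd (card (B \<inter> y)))}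
          \<le> nstates n \<kappa> ?E (U - {v, w})"
        unfolding SE[OF y bex] by (simp only: nstates_def V_def)
      moreover have "nstates n \<kappa> ?E U = card S"
        using SE[OF y bex] by (simp add: nstates_def V_def)
      moreover have "card S \<le> 4 * card {B \<in> S. \<not> (odd_deg E v B \<noteq> odd (card (B \<inter> y)))}"
        using yG by (simp add: G_def)
      ultimately have "phase1 n \<kappa> ?E (Suc j) = U - {v, w}"
        using S1 by (intro acc[OF y bex]) linarith+
      then show ?thesis using bex by blast
    qed
    ultimately show ?thesis using that[of G]
      by (auto simp: M_def v_def w_def z_def G_def)
  qed
qed

text \<open>Acceptance divides the weight by \<open>4\<close> and has conditional probability at
  least \<open>1 / 3 * 1 / 8\<close>; rejection keeps the weight. This gives the factor
  \<open>1 - 3 / 4 * (1 / 24) = 31 / 32\<close>.\<close>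

lemma sum_phase1_weight_step:
  assumes j: "2 * j + 2 < n"
  shows "(\<Sum>E\<in>graphs n. (1 / 2 :: real) ^ (n - card (phase1 n \<kappa> E (Suc j))))
    \<le> (\<Sum>E\<in>graphs n. 31 / 32 * (1 / 2) ^ (n - card (phase1 n \<kappa> E j)))"
proof -
  define v w z where "v = 2 * j" and "w = 2 * j + 1" and "z = n - 1"
  define ex where "ex = {{v, w}, {v, z}, {w, z}}"
  define Y where "Y = Pow {..<2 * j} \<times> Pow ex"
  define F where "F = (\<lambda>(y, b). star v z y \<union> b)"
  have neq: "v \<noteq> w" "v \<noteq> z" "w \<noteq> z" using j by (auto simp: v_def w_def z_def)
  have "card ex = 3" using neq by (auto simp: ex_def doubleton_eq_iff card_insert_if)
  then have cY: "card Y = 8 * 2 ^ (2 * j)"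
    by (simp add: Y_def card_Pow card_cartesian_product ex_def)
  have fY: "finite Y" by (simp add: Y_def ex_def)
  have lt: "v < w" "w < z" "z < n" "v < z" "w < n" using j by (auto simp: v_def w_def z_def)
  then have "ex \<subseteq> all_edges n" by (auto simp: ex_def intro: all_edgesI)
  then have FE: "F p \<subseteq> all_edges n" if "p \<in> Y" for p
    using that star_subset[of "fst p" v z n] lt
    by (auto simp: Y_def F_def v_def)
  show ?thesis
  proof (rule sum_le_by_toggle[OF FE fY])
    show "Y \<noteq> {}" using cY by auto
    fix E
    define U where "U = phase1 n \<kappa> E j"
    define \<omega> :: real where "\<omega> = (1 / 2) ^ (n - card U)"
    define h where "h = (\<lambda>p. (1 / 2 :: real) ^ (n - card (phase1 n \<kappa> (toggle E (F p)) (Suc j))))"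
    obtain G where G: "G \<subseteq> Pow {..<2 * j}" "2 ^ (2 * j) \<le> 3 * card G"
      "\<And>y. y \<in> G \<Longrightarrow> \<exists>b\<in>Pow ex. phase1 n \<kappa> (toggle E (star v z y \<union> b)) (Suc j) = U - {v, w}"
      using phase1_accept[OF j U_def] unfolding ex_def v_def w_def z_def by metis
    then obtain \<beta> where \<beta>: "\<And>y. y \<in> G \<Longrightarrow> \<beta> y \<in> Pow ex \<and>
        phase1 n \<kappa> (toggle E (star v z y \<union> \<beta> y)) (Suc j) = U - {v, w}"
      by metis
    define A where "A = (\<lambda>y. (y, \<beta> y)) ` G"
    have AY: "A \<subseteq> Y" using G(1) \<beta> by (auto simp: A_def Y_def)
    have cA: "card A = card G" unfolding A_def by (rule card_image) (auto simp: inj_on_def)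
    have cU: "n - card (U - {v, w}) = n - card U + 2"
      unfolding U_def v_def w_def using j by (intro card_phase1_accept) simp
    have hA: "h p = \<omega> / 4" if "p \<in> A" for p
      using that \<beta> cU by (auto simp: A_def h_def F_def \<omega>_def power_add power2_eq_square)
    have hY: "h p \<le> \<omega>" if "p \<in> Y" for p
    proof -
      have exM: "e \<inter> {..<2 * j} = {}" if "e \<in> ex" for e
        using that j by (auto simp: ex_def v_def w_def z_def)
      have "agree {..<n} {..<2 * j} E (toggle E (F p))"
      proof -
        obtain y b where p: "p = (y, b)" by (cases p)
        show ?thesis unfolding p F_def prod.case
          by (rule agree_toggle) (use \<open>p \<in> Y\<close> neq exM j in \<open>auto simp: p Y_def v_def z_def\<close>)
      qed
      then have "phase1 n \<kappa> (toggle E (F p)) j = U" unfolding U_def by (rule agree_phase1[symmetric])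
      then have "phase1 n \<kappa> (toggle E (F p)) (Suc j) \<subseteq> U" by (auto simp: Let_def)
      moreover have "finite U" unfolding U_def by (rule finite_subset[OF phase1_subset]) simp
      ultimately have "card (phase1 n \<kappa> (toggle E (F p)) (Suc j)) \<le> card U" by (rule card_mono[rotated])
      then show ?thesis unfolding h_def \<omega>_def by (intro power_decreasing) auto
    qed
    have \<omega>: "\<omega> \<ge> 0" by (simp add: \<omega>_def)
    have "(\<Sum>p\<in>Y. h p) = (\<Sum>p\<in>Y - A. h p) + (\<Sum>p\<in>A. h p)"
      using AY fY by (rule sum.subset_diff)
    also have "\<dots> \<le> (\<Sum>p\<in>Y - A. \<omega>) + (\<Sum>p\<in>A. \<omega> / 4)"
      using hA hY by (intro add_mono sum_mono) auto
    also have "\<dots> = \<omega> * (real (card Y) - 3 / 4 * real (card G))"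
    proof -
      have "card (Y - A) = card Y - card G" "card G \<le> card Y"
        using AY fY cA card_mono[OF fY AY] by (simp_all add: card_Diff_subset finite_subset)
      then show ?thesis using cA by (simp add: of_nat_diff algebra_simps)
    qed
    also have "\<dots> \<le> \<omega> * (31 / 32 * real (card Y))"
    proof (rule mult_left_mono[OF _ \<omega>])
      have "real (2 ^ (2 * j)) \<le> real (3 * card G)" using G(2) by (simp only: of_nat_le_iff)
      then show "real (card Y) - 3 / 4 * real (card G) \<le> 31 / 32 * real (card Y)"
        using cY by simp
    qed
    finally show "(\<Sum>p\<in>Y. (1 / 2 :: real) ^ (n - card (phase1 n \<kappa> (toggle E (F p)) (Suc j))))
        \<le> 31 / 32 * (1 / 2) ^ (n - card (phase1 n \<kappa> E j)) * real (card Y)"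
      by (simp add: h_def \<omega>_def U_def mult_ac)
  qed
qed

lemma sum_phase1_weight:
  assumes "2 * m < n"
  shows "(\<Sum>E\<in>graphs n. (1 / 2 :: real) ^ (n - card (phase1 n \<kappa> E m)))
    \<le> (31 / 32) ^ m * real (card (graphs n))"
  using assms
proof (induction m)
  case (Suc m)
  have "(\<Sum>E\<in>graphs n. (1 / 2 :: real) ^ (n - card (phase1 n \<kappa> E (Suc m))))
      \<le> 31 / 32 * (\<Sum>E\<in>graphs n. (1 / 2) ^ (n - card (phase1 n \<kappa> E m)))"
    using sum_phase1_weight_step[of m n \<kappa>] Suc.prems by (simp add: sum_distrib_left)
  also have "\<dots> \<le> 31 / 32 * ((31 / 32) ^ m * real (card (graphs n)))"
    using Suc by (intro mult_left_mono) auto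
  finally show ?case by (simp add: mult_ac)
qed simp

text \<open>Markov's inequality for the weight, which exceeds \<open>(1 / 2) ^ s\<close> on the
  graphs counted.\<close>

lemma card_phase1_short:
  assumes "2 * m < n"
  shows "real (card {E \<in> graphs n. n - card (phase1 n \<kappa> E m) < s})
    \<le> 2 ^ s * (31 / 32) ^ m * real (card (graphs n))"
proof -
  let ?A = "{E \<in> graphs n. n - card (phase1 n \<kappa> E m) < s}"
  have "real (card ?A) * (1 / 2) ^ s \<le> (\<Sum>E\<in>?A. (1 / 2 :: real) ^ (n - card (phase1 n \<kappa> E m)))"
    by (rule sum_bounded_below[of ?A "(1 / 2 :: real) ^ s", simplified])
      (auto intro!: power_decreasing)
  also have "\<dots> \<le> (\<Sum>E\<in>graphs n. (1 / 2 :: real) ^ (n - card (phase1 n \<kappa> E m)))"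
    by (rule sum_mono2[OF finite_graphs]) auto
  also have "\<dots> \<le> (31 / 32) ^ m * real (card (graphs n))" by (rule sum_phase1_weight[OF assms])
  finally show ?thesis by (simp add: power_divide field_simps)
qed

section \<open>Phase 2: processing the remaining vertices\<close>

text \<open>Each step removes the next fresh vertex unconditionally. The guard
  \<open>p < 2 * m\<close> says that the minimum left is a vertex rejected in phase 1; it goes only
  when odd, which costs no states.\<close>

primrec phase2 :: "nat \<Rightarrow> bool \<Rightarrow> nat \<Rightarrow> nat set set \<Rightarrow> nat \<Rightarrow> nat set" where
  "phase2 n \<kappa> m E 0 = phase1 n \<kappa> E m"
| "phase2 n \<kappa> m E (Suc i) =
     (let U = phase2 n \<kappa> m E i - {2 * m + i}; p = Min U in
      if p < 2 * m \<and> odd_deg E p U then U - {p} else U)"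

lemma phase2_subset: "phase2 n \<kappa> m E i \<subseteq> {..<n}"
  by (induction i) (use phase1_subset in \<open>auto simp: Let_def\<close>)

lemma phase2_superset: "{2 * m + i..<n} \<subseteq> phase2 n \<kappa> m E i"
proof (induction i)
  case (Suc i)
  have "{2 * m + Suc i..<n} \<subseteq> phase2 n \<kappa> m E i - {2 * m + i}" using Suc by auto
  then show ?case by (auto simp: Let_def)
qed (use phase1_superset in auto)

lemma phase2_gap: "phase2 n \<kappa> m E i \<inter> {2 * m..<2 * m + i} = {}"
proof (induction i)
  case (Suc i)
  have "phase2 n \<kappa> m E (Suc i) \<subseteq> phase2 n \<kappa> m E i - {2 * m + i}" by (auto simp: Let_def)
  moreover have "{2 * m..<2 * m + Suc i} = insert (2 * m + i) {2 * m..<2 * m + i}" by auto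
  ultimately show ?case using Suc by blast
qed simp

lemma agree_phase2:
  "2 * m + i < n \<Longrightarrow> agree {..<n} {..<2 * m + i} E E' \<Longrightarrow> phase2 n \<kappa> m E i = phase2 n \<kappa> m E' i"
proof (induction i)
  case 0
  then show ?case using agree_phase1[of n m E E' \<kappa>] by simp
next
  case (Suc i)
  define U where "U = phase2 n \<kappa> m E i - {2 * m + i}"
  have "agree {..<n} {..<2 * m + i} E E'" by (rule agree_antimono[OF _ Suc(3)]) auto
  then have U': "phase2 n \<kappa> m E' i - {2 * m + i} = U" using Suc by (simp add: U_def)
  have sub: "{..<n} - {..<2 * m + Suc i} \<subseteq> U" "U \<subseteq> {..<n}"
    using phase2_superset[of m i n \<kappa> E] phase2_subset[of n \<kappa> m E i] by (auto simp: U_def)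
  have "odd_deg E p U = odd_deg E' p U" if "p < 2 * m" for p
    by (rule agree_odd_deg[OF _ Suc(3) _ sub]) (use that in auto)
  then show ?case using U' U_def by (auto simp: Let_def)
qed

lemma phase2_toggle:
  assumes "2 * m + i + 1 < n" "y \<subseteq> {..<2 * m + i}"
  shows "phase2 n \<kappa> m (toggle E (star (2 * m + i) (n - 1) y)) i = phase2 n \<kappa> m E i"
proof -
  have "agree {..<n} {..<2 * m + i} E (toggle E (star (2 * m + i) (n - 1) y \<union> {}))"
    by (rule agree_toggle) (use assms in auto)
  then show ?thesis using agree_phase2[of m i n E "toggle E (star (2 * m + i) (n - 1) y)" \<kappa>] assms
    by simp
qed

lemma card_subsets_mem:
  assumes "finite M" "p \<in> M"
  shows "card {y \<in> Pow M. (p \<in> y) \<noteq> c} = 2 ^ (card M - 1)"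
proof -
  have c0: "card {y \<in> Pow M. p \<notin> y} = 2 ^ (card M - 1)"
  proof -
    have "{y \<in> Pow M. p \<notin> y} = Pow (M - {p})" by auto
    then show ?thesis using assms by (simp add: card_Pow)
  qed
  have "{y \<in> Pow M. p \<in> y} = insert p ` Pow (M - {p})"
  proof (intro subset_antisym subsetI)
    fix y assume "y \<in> {y \<in> Pow M. p \<in> y}"
    then show "y \<in> insert p ` Pow (M - {p})"
      by (intro image_eqI[of _ _ "y - {p}"]) auto
  qed (use assms in auto)
  moreover have "inj_on (insert p) (Pow (M - {p}))"
    by (rule inj_on_inverseI[where g = "\<lambda>y. y - {p}"]) auto
  ultimately have "card {y \<in> Pow M. p \<in> y} = 2 ^ (card M - 1)"
    using assms by (simp add: card_image card_Pow)
  then show ?thesis using c0 by (cases c) simp_all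
qed

section \<open>Clearing the rejected vertices\<close>

definition rejects :: "nat \<Rightarrow> bool \<Rightarrow> nat \<Rightarrow> nat set set \<Rightarrow> nat \<Rightarrow> nat set" where
  "rejects n \<kappa> m E i = phase2 n \<kappa> m E i \<inter> {..<2 * m}"

text \<open>Value \<open>0\<close> on the empty set keeps the drift estimate valid after clearing is
  complete; otherwise the weight is at least \<open>1\<close>, as Markov's inequality needs.\<close>

definition rej_weight :: "nat \<Rightarrow> bool \<Rightarrow> nat \<Rightarrow> nat set set \<Rightarrow> nat \<Rightarrow> real" where
  "rej_weight n \<kappa> m E i = (if rejects n \<kappa> m E i = {} then 0 else 2 ^ card (rejects n \<kappa> m E i))"

text \<open>\<open>U\<close> has lost \<open>v\<close> but still contains \<open>z\<close>, so the
  star toggle flips the parity of \<open>p\<close> in \<open>U\<close> exactly when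
  \<open>p \<in> y\<close>. Half of the choices remove \<open>p\<close> and at least halve the
  weight, so its mean factor is at most \<open>3 / 4\<close>.\<close>

lemma sum_rej_weight_step:
  assumes i: "2 * m + i + 1 < n"
  shows "(\<Sum>E\<in>graphs n. rej_weight n \<kappa> m E (Suc i)) \<le> (\<Sum>E\<in>graphs n. 3 / 4 * rej_weight n \<kappa> m E i)"
proof (rule sum_le_by_toggle)
  define v z where "v = 2 * m + i" and "z = n - 1"
  define M where "M = {..<v}"
  show "star v z y \<subseteq> all_edges n" if "y \<in> Pow M" for y
    using that star_subset[of y v z n] i by (auto simp: v_def z_def M_def)
  show "finite (Pow M)" "Pow M \<noteq> {}" by (auto simp: M_def)
  fix E
  define U where "U = phase2 n \<kappa> m E i - {v}"
  define L where "L = rejects n \<kappa> m E i"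
  define p where "p = Min U"
  have step: "phase2 n \<kappa> m (toggle E (star v z y)) (Suc i)
      = (if p < 2 * m \<and> odd_deg (toggle E (star v z y)) p U then U - {p} else U)" if "y \<in> Pow M" for y
    using phase2_toggle[OF i, of y \<kappa> E] that by (simp add: Let_def U_def p_def v_def z_def M_def)
  have LU: "U \<inter> {..<2 * m} = L" by (auto simp: U_def L_def rejects_def v_def)
  have fU: "finite U" using phase2_subset[of n \<kappa> m E i] by (auto simp: U_def finite_subset)
  show "(\<Sum>y\<in>Pow M. rej_weight n \<kappa> m (toggle E (star v z y)) (Suc i))
      \<le> 3 / 4 * rej_weight n \<kappa> m E i * real (card (Pow M))"
  proof (cases "L = {}")
    case True
    have "rej_weight n \<kappa> m (toggle E (star v z y)) (Suc i) = 0" if "y \<in> Pow M" for y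
    proof -
      have "rejects n \<kappa> m (toggle E (star v z y)) (Suc i) \<subseteq> U \<inter> {..<2 * m}"
        unfolding rejects_def step[OF that] by auto
      then show ?thesis using LU True by (simp add: rej_weight_def)
    qed
    then show ?thesis by (simp add: rej_weight_def)
  next
    case False
    then obtain q where q: "q \<in> L" by auto
    have pU: "p \<in> U" unfolding p_def using fU q LU by (intro Min_in) auto
    have "p \<le> q" unfolding p_def using fU q LU by (intro Min_le) auto
    moreover have "q < 2 * m" using q LU by blast
    ultimately have p1: "p < 2 * m" by simp
    then have p2: "p \<in> L" using LU pU by blast
    have p3: "p \<in> M" using p1 by (simp add: M_def v_def)
    note p = p1 p2 p3
    have fL: "finite L" using LU fU by auto
    have zU: "z \<in> U" "v \<notin> U"
      using phase2_superset[of m i n \<kappa> E] i by (auto simp: U_def v_def z_def)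
    have dgp: "odd_deg (toggle E (star v z y)) p U \<longleftrightarrow> (p \<in> y) \<noteq> odd_deg E p U" if "y \<in> Pow M" for y
    proof -
      have "odd_deg (star v z y \<union> {}) p U \<longleftrightarrow> p \<in> y \<and> (v \<in> U) \<noteq> (z \<in> U)"
        by (rule odd_deg_star_M[of y M]) (use that p i in \<open>auto simp: M_def v_def z_def\<close>)
      then show ?thesis using zU odd_deg_toggle[OF fU] by auto
    qed
    define Y1 where "Y1 = {y \<in> Pow M. (p \<in> y) \<noteq> odd_deg E p U}"
    have cY: "card (Pow M) = 2 * card Y1" "card (Pow M - Y1) = card Y1"
    proof -
      have "card M \<noteq> 0" using p by (auto simp: M_def)
      moreover have "card Y1 = 2 ^ (card M - 1)" unfolding Y1_def
        using p by (intro card_subsets_mem) (auto simp: M_def)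
      ultimately show "card (Pow M) = 2 * card Y1"
        by (simp add: card_Pow M_def power_eq_if)
      then show "card (Pow M - Y1) = card Y1"
        by (subst card_Diff_subset) (auto simp: Y1_def M_def)
    qed
    have w1: "rej_weight n \<kappa> m (toggle E (star v z y)) (Suc i) \<le> 2 ^ card L / 2" if "y \<in> Y1" for y
    proof -
      have "rejects n \<kappa> m (toggle E (star v z y)) (Suc i) = L - {p}"
        using step[of y] dgp[of y] that p LU unfolding rejects_def Y1_def by auto
      moreover have "(2 :: real) ^ card L = 2 * 2 ^ card (L - {p})"
        using card_Suc_Diff1[OF fL p2] by (metis power_Suc)
      ultimately show ?thesis unfolding rej_weight_def by simp
    qed
    have w2: "rej_weight n \<kappa> m (toggle E (star v z y)) (Suc i) \<le> 2 ^ card L" if "y \<in> Pow M - Y1" for y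
    proof -
      have "rejects n \<kappa> m (toggle E (star v z y)) (Suc i) = L"
        using step[of y] dgp[of y] that LU unfolding rejects_def Y1_def by auto
      then show ?thesis by (simp add: rej_weight_def)
    qed
    have "(\<Sum>y\<in>Pow M. rej_weight n \<kappa> m (toggle E (star v z y)) (Suc i))
      = (\<Sum>y\<in>Pow M - Y1. rej_weight n \<kappa> m (toggle E (star v z y)) (Suc i))
        + (\<Sum>y\<in>Y1. rej_weight n \<kappa> m (toggle E (star v z y)) (Suc i))"
      by (rule sum.subset_diff) (auto simp: Y1_def M_def)
    also have "\<dots> \<le> (\<Sum>y\<in>Pow M - Y1. 2 ^ card L) + (\<Sum>y\<in>Y1. 2 ^ card L / 2)"
      using w1 w2 by (intro add_mono sum_mono) auto
    also have "\<dots> = 3 / 4 * 2 ^ card L * real (card (Pow M))"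
      using cY by (simp add: field_simps)
    finally show ?thesis using False by (simp add: rej_weight_def L_def)
  qed
qed

text \<open>At most \<open>2 * m\<close> vertices are rejected, so the weight starts at no more than
  \<open>4 ^ m\<close>; iterate the drift and apply Markov's inequality.\<close>

lemma card_rejects:
  assumes "2 * m + r < n"
  shows "real (card {E \<in> graphs n. rejects n \<kappa> m E r \<noteq> {}}) \<le> 4 ^ m * (3 / 4) ^ r * real (card (graphs n))"
proof -
  have w: "(\<Sum>E\<in>graphs n. rej_weight n \<kappa> m E r) \<le> (3 / 4) ^ r * (4 ^ m * real (card (graphs n)))"
    using assms
  proof (induction r)
    case 0
    have "rej_weight n \<kappa> m E 0 \<le> 4 ^ m" for E
    proof -
      have "card (rejects n \<kappa> m E 0) \<le> card {..<2 * m}"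
        by (rule card_mono) (auto simp: rejects_def)
      then have "(2 :: real) ^ card (rejects n \<kappa> m E 0) \<le> 2 ^ (2 * m)"
        by (intro power_increasing) auto
      then show ?thesis by (simp add: rej_weight_def power_mult)
    qed
    then show ?case using sum_mono[of "graphs n" "\<lambda>E. rej_weight n \<kappa> m E 0" "\<lambda>_. 4 ^ m"]
      by (simp add: mult.commute)
  next
    case (Suc r)
    have "(\<Sum>E\<in>graphs n. rej_weight n \<kappa> m E (Suc r)) \<le> 3 / 4 * (\<Sum>E\<in>graphs n. rej_weight n \<kappa> m E r)"
      using sum_rej_weight_step[of m r n \<kappa>] Suc.prems by (simp add: sum_distrib_left)
    also have "\<dots> \<le> 3 / 4 * ((3 / 4) ^ r * (4 ^ m * real (card (graphs n))))"
      using Suc by (intro mult_left_mono) auto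
    finally show ?case by (simp add: mult_ac)
  qed
  let ?A = "{E \<in> graphs n. rejects n \<kappa> m E r \<noteq> {}}"
  have "real (card ?A) \<le> (\<Sum>E\<in>?A. rej_weight n \<kappa> m E r)"
    by (rule sum_bounded_below[of ?A "1 :: real", simplified]) (auto simp: rej_weight_def)
  also have "\<dots> \<le> (\<Sum>E\<in>graphs n. rej_weight n \<kappa> m E r)"
    by (rule sum_mono2[OF finite_graphs]) (auto simp: rej_weight_def)
  finally show ?thesis using w by (simp add: mult_ac)
qed

text \<open>Neither an odd fresh vertex nor a cleared rejected vertex loses states. For an even
  fresh vertex the new count is at least twice the number of states it is even to, which is
  controlled by Chebyshev over \<open>y\<close>.\<close>

lemma nstates_phase2_drop:
  fixes \<delta> :: real
  assumes i: "2 * m + i + 1 < n" and \<delta>: "0 < \<delta>" "\<delta> < 1"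
  shows "\<delta>\<^sup>2 * real (nstates n \<kappa> E (phase2 n \<kappa> m E i)) *
     real (card {y \<in> Pow {..<2 * m + i}.
       real (nstates n \<kappa> (toggle E (star (2 * m + i) (n - 1) y))
         (phase2 n \<kappa> m (toggle E (star (2 * m + i) (n - 1) y)) (Suc i)))
       < (1 - \<delta>) * real (nstates n \<kappa> E (phase2 n \<kappa> m E i))}) \<le> 2 ^ (2 * m + i)"
proof -
  define v z M V where "v = 2 * m + i" and "z = n - 1" and "M = {..<v}" and "V = {..<n}"
  define U where "U = phase2 n \<kappa> m E i"
  define S where "S = states V \<kappa> E U"
  define E' where "E' = (\<lambda>y. toggle E (star v z y))"
  have U: "v \<in> U" "U \<subseteq> V" "V - M \<subseteq> U" "finite U" "finite V"
    using phase2_superset[of m i n \<kappa> E] phase2_subset[of n \<kappa> m E i] i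
    by (auto simp: U_def V_def M_def v_def finite_subset)
  have neq: "v \<noteq> z" "v \<notin> M" "z \<notin> M" "v \<in> V" "z \<in> V" using i by (auto simp: v_def z_def M_def V_def)
  have SM: "S \<subseteq> Pow M" using U(3) by (auto simp: S_def states_def)
  have big: "2 * real (card {B \<in> S. \<not> (odd_deg E v B \<noteq> odd (card (B \<inter> y)))}) < (1 - \<delta>) * real (card S)"
    if y: "y \<in> Pow M" and
      small: "real (nstates n \<kappa> (E' y) (phase2 n \<kappa> m (E' y) (Suc i))) < (1 - \<delta>) * real (card S)" for y
  proof -
    have yM: "y \<subseteq> M" using y by auto
    have ag: "agree V M E (E' y)"
      using agree_toggle[of V v M z y "{}" E] U neq yM by (simp add: E'_def)
    have SE: "states V \<kappa> (E' y) U = S"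
      using agree_states_superset[OF U(5) ag U(3,2)] by (simp add: S_def)
    define U' where "U' = U - {v}"
    have step: "phase2 n \<kappa> m (E' y) (Suc i)
        = (if Min U' < 2 * m \<and> odd_deg (E' y) (Min U') U' then U' - {Min U'} else U')"
      using phase2_toggle[OF i, of y \<kappa> E] yM
      by (simp add: Let_def U_def U'_def E'_def v_def z_def M_def)
    have U'V: "U' \<subseteq> V" "finite U'" using U by (auto simp: U'_def)
    have "z \<in> U'" using U(3) neq by (auto simp: U'_def)
    then have "Min U' \<in> U'" using U'V by (intro Min_in) auto
    then have "card (states V \<kappa> (E' y) U') \<le> card (states V \<kappa> (E' y) (phase2 n \<kappa> m (E' y) (Suc i)))"
      unfolding step using card_states_remove_odd[OF U(5) U'V(1)] by auto
    then have few: "real (card (states V \<kappa> (E' y) U')) < (1 - \<delta>) * real (card S)"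
      using small by (simp add: nstates_def V_def)
    have "\<not> odd_deg (E' y) v U"
    proof
      assume "odd_deg (E' y) v U"
      then have "card S \<le> card (states V \<kappa> (E' y) U')"
        using card_states_remove_odd[OF U(5,2,1), of "E' y" \<kappa>] SE by (simp add: U'_def)
      then have "real (card S) < (1 - \<delta>) * real (card S)" using few by linarith
      then show False using \<delta> by (simp add: mult_less_cancel_right1 algebra_simps)
        (metis mult_nonneg_nonneg of_nat_0_le_iff order_less_le leD)
    qed
    then have even: "2 * card {B \<in> S. \<not> odd_deg (E' y) v B} \<le> card (states V \<kappa> (E' y) U')"
      using card_states_remove_even[OF U(5,2,1), of "E' y" \<kappa>] SE by (simp add: U'_def)
    have "odd_deg (E' y) v B \<longleftrightarrow> odd_deg E v B \<noteq> odd (card (B \<inter> y))" if "B \<in> S" for B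
    proof -
      have B: "B \<subseteq> M" "finite B" using that SM by (auto simp: M_def finite_subset)
      have "odd_deg (star v z y \<union> {}) v B \<longleftrightarrow> odd (card (B \<inter> y))"
        by (rule odd_deg_star_v[OF yM neq(2,3,1) B(1)]) auto
      then show ?thesis using odd_deg_toggle[OF B(2)] by (simp add: E'_def)
    qed
    then have eq: "{B \<in> S. \<not> odd_deg (E' y) v B} = {B \<in> S. \<not> (odd_deg E v B \<noteq> odd (card (B \<inter> y)))}" by auto
    show ?thesis unfolding eq[symmetric] using few even by linarith
  qed
  have "real (card {y \<in> Pow M. real (nstates n \<kappa> (E' y) (phase2 n \<kappa> m (E' y) (Suc i))) < (1 - \<delta>) * real (card S)})
      \<le> real (card {y \<in> Pow M. 2 * real (card {B \<in> S. \<not> (odd_deg E v B \<noteq> odd (card (B \<inter> y)))}) < (1 - \<delta>) * real (card S)})"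
    (is "real (card ?A) \<le> real (card ?B)")
    using big by (intro of_nat_mono card_mono) (auto simp: M_def)
  then have "\<delta>\<^sup>2 * real (card S) * real (card ?A) \<le> \<delta>\<^sup>2 * real (card S) * real (card ?B)"
    by (intro mult_left_mono) auto
  also have "\<dots> \<le> 2 ^ card M"
    by (rule rarely_few_even[where d = "odd_deg E v"]) (use SM \<delta> in \<open>auto simp: M_def\<close>)
  finally show ?thesis by (simp add: M_def S_def U_def E'_def V_def v_def z_def nstates_def)
qed

text \<open>Graphs already below \<open>K\<close> are charged to the first summand. All others have
  at least \<open>K\<close> states, so the relative drop has probability at most
  \<open>1 / (\<delta>\<^sup>2 * K)\<close>.\<close>

lemma card_few_states_step:
  fixes \<delta> K :: real
  assumes i: "2 * m + i + 1 < n" and \<delta>: "0 < \<delta>" "\<delta> < 1" and K: "0 < K"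
  shows "real (card {E \<in> graphs n. real (nstates n \<kappa> E (phase2 n \<kappa> m E (Suc i))) < (1 - \<delta>) * K})
    \<le> real (card {E \<in> graphs n. real (nstates n \<kappa> E (phase2 n \<kappa> m E i)) < K})
      + real (card (graphs n)) / (\<delta>\<^sup>2 * K)"
proof -
  define v z M where "v = 2 * m + i" and "z = n - 1" and "M = {..<v}"
  define N where "N = (\<lambda>E i. real (nstates n \<kappa> E (phase2 n \<kappa> m E i)))"
  define h :: "nat set set \<Rightarrow> real" where "h = (\<lambda>E. if N E (Suc i) < (1 - \<delta>) * K then 1 else 0)"
  define g where "g = (\<lambda>E. (if N E i < K then 1 else 0) + 1 / (\<delta>\<^sup>2 * K))"
  have "(\<Sum>E\<in>graphs n. h E) \<le> (\<Sum>E\<in>graphs n. g E)"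
  proof (rule sum_le_by_toggle)
    show "star v z y \<subseteq> all_edges n" if "y \<in> Pow M" for y
      using that star_subset[of y v z n] i by (auto simp: v_def z_def M_def)
    show "finite (Pow M)" "Pow M \<noteq> {}" by (auto simp: M_def)
    fix E
    define A where "A = {y \<in> Pow M. N (toggle E (star v z y)) (Suc i) < (1 - \<delta>) * K}"
    have fA: "finite A" "A \<subseteq> Pow M" by (auto simp: A_def M_def)
    have pos: "0 < \<delta>\<^sup>2 * K" using \<delta> K by simp
    have "(\<Sum>y\<in>Pow M. h (toggle E (star v z y))) = real (card A)"
      unfolding h_def A_def by (simp add: sum.If_cases M_def Int_def conj_commute)
    also have "\<dots> \<le> g E * real (card (Pow M))"
    proof (cases "N E i < K")
      case True
      have "real (card A) \<le> 1 * real (card (Pow M))" using fA by (simp add: card_mono M_def)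
      also have "\<dots> \<le> g E * real (card (Pow M))"
        using True pos by (intro mult_right_mono) (auto simp: g_def)
      finally show ?thesis .
    next
      case False
      then have KN: "K \<le> N E i" by simp
      let ?B = "{y \<in> Pow M. N (toggle E (star v z y)) (Suc i) < (1 - \<delta>) * N E i}"
      have "(1 - \<delta>) * K \<le> (1 - \<delta>) * N E i" using KN \<delta> by (intro mult_left_mono) auto
      then have "card A \<le> card ?B" unfolding A_def by (intro card_mono) (auto simp: M_def)
      then have "\<delta>\<^sup>2 * K * real (card A) \<le> \<delta>\<^sup>2 * N E i * real (card ?B)"
        using KN K by (intro mult_mono) auto
      also have "\<dots> \<le> 2 ^ v"
        using nstates_phase2_drop[OF i \<delta>, of \<kappa> E] by (simp add: N_def M_def v_def z_def)
      finally have "real (card A) \<le> 2 ^ v / (\<delta>\<^sup>2 * K)" using pos by (simp add: field_simps)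
      then show ?thesis using False by (simp add: g_def card_Pow M_def)
    qed
    finally show "(\<Sum>y\<in>Pow M. h (toggle E (star v z y))) \<le> g E * real (card (Pow M))" .
  qed
  moreover have "(\<Sum>E\<in>graphs n. h E) = real (card {E \<in> graphs n. N E (Suc i) < (1 - \<delta>) * K})"
    unfolding h_def by (simp add: sum.If_cases finite_graphs Int_def conj_commute)
  moreover have "(\<Sum>E\<in>graphs n. g E) = real (card {E \<in> graphs n. N E i < K}) + real (card (graphs n)) / (\<delta>\<^sup>2 * K)"
    unfolding g_def by (simp add: sum.distrib sum.If_cases finite_graphs Int_def conj_commute)
  ultimately show ?thesis by (simp add: N_def)
qed

lemma card_few_states:
  fixes K :: real
  assumes r: "2 * m + r < n" and K: "0 < K"
  shows "real (card {E \<in> graphs n. real (nstates n \<kappa> E (phase2 n \<kappa> m E r)) < K / 2})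
    \<le> real (card {E \<in> graphs n. real (nstates n \<kappa> E (phase1 n \<kappa> E m)) < K})
      + 8 * real n ^ 3 / K * real (card (graphs n))"
proof -
  \<comment> \<open>With at most \<open>n\<close> steps, Bernoulli's inequality keeps the threshold
    above \<open>K / 2\<close>; each step then fails with probability at most
    \<open>8 * n\<^sup>2 / K\<close>.\<close>
  define \<delta> where "\<delta> = 1 / (2 * real n)"
  have n: "n > 0" using r by simp
  have \<delta>: "0 < \<delta>" "\<delta> < 1" using n by (auto simp: \<delta>_def)
  have bern: "1 / 2 \<le> (1 - \<delta>) ^ i" if "i \<le> n" for i
  proof -
    have "1 + real i * (- \<delta>) \<le> (1 + (- \<delta>)) ^ i" using \<delta> by (intro Bernoulli_inequality) simp
    moreover have "real i * \<delta> \<le> 1 / 2" using that n by (simp add: \<delta>_def field_simps)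
    ultimately show ?thesis by simp
  qed
  have "real (card {E \<in> graphs n. real (nstates n \<kappa> E (phase2 n \<kappa> m E i)) < (1 - \<delta>) ^ i * K})
      \<le> real (card {E \<in> graphs n. real (nstates n \<kappa> E (phase1 n \<kappa> E m)) < K})
        + real i * (8 * real n ^ 2 / K * real (card (graphs n)))" if "i \<le> r" for i
    using that
  proof (induction i)
    case (Suc i)
    have i: "2 * m + i + 1 < n" "i \<le> n" using Suc.prems r by auto
    have K': "0 < (1 - \<delta>) ^ i * K" using \<delta> K by simp
    have "real (card (graphs n)) / (\<delta>\<^sup>2 * ((1 - \<delta>) ^ i * K)) \<le> real (card (graphs n)) / (\<delta>\<^sup>2 * (1 / 2 * K))"
      using bern[OF i(2)] \<delta> K by (intro divide_left_mono mult_left_mono mult_right_mono) auto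
    also have "\<dots> = 8 * real n ^ 2 / K * real (card (graphs n))"
      using n by (simp add: \<delta>_def power2_eq_square field_simps)
    finally have "real (card {E \<in> graphs n. real (nstates n \<kappa> E (phase2 n \<kappa> m E (Suc i))) < (1 - \<delta>) * ((1 - \<delta>) ^ i * K)})
        \<le> real (card {E \<in> graphs n. real (nstates n \<kappa> E (phase2 n \<kappa> m E i)) < (1 - \<delta>) ^ i * K})
          + 8 * real n ^ 2 / K * real (card (graphs n))"
      using card_few_states_step[OF i(1) \<delta> K', of \<kappa>] by linarith
    then show ?case
      using Suc unfolding power_Suc mult.assoc of_nat_Suc distrib_right by linarith
  qed simp
  from this[of r] have 1: "real (card {E \<in> graphs n. real (nstates n \<kappa> E (phase2 n \<kappa> m E r)) < (1 - \<delta>) ^ r * K})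
      \<le> real (card {E \<in> graphs n. real (nstates n \<kappa> E (phase1 n \<kappa> E m)) < K})
        + real r * (8 * real n ^ 2 / K * real (card (graphs n)))" by simp
  have "1 / 2 * K \<le> (1 - \<delta>) ^ r * K" using bern[of r] r K by (intro mult_right_mono) auto
  then have "{E \<in> graphs n. real (nstates n \<kappa> E (phase2 n \<kappa> m E r)) < K / 2}
      \<subseteq> {E \<in> graphs n. real (nstates n \<kappa> E (phase2 n \<kappa> m E r)) < (1 - \<delta>) ^ r * K}"
    by (intro Collect_mono) linarith
  then have "real (card {E \<in> graphs n. real (nstates n \<kappa> E (phase2 n \<kappa> m E r)) < K / 2})
      \<le> real (card {E \<in> graphs n. real (nstates n \<kappa> E (phase2 n \<kappa> m E r)) < (1 - \<delta>) ^ r * K})"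
    by (intro of_nat_mono card_mono) (simp_all add: finite_graphs)
  moreover have "real r * (8 * real n ^ 2 / K * real (card (graphs n)))
      \<le> real n * (8 * real n ^ 2 / K * real (card (graphs n)))"
    using r K by (intro mult_right_mono) auto
  ultimately show ?thesis using 1 by (simp add: power3_eq_cube power2_eq_square algebra_simps)
qed

text \<open>The toggles may change the edge parity, so both phases were analysed for a fixed
  \<open>\<kappa>\<close>. The bad events for both values are united here, whence the factor
  \<open>2\<close>; each graph uses the value matching its own parity.\<close>

lemma card_not_even_degenerate_le:
  assumes n: "2 * m + 1 < n" and s: "0 < s"
  shows "real (card {E \<in> graphs n. \<not> even_degenerate n E}) \<le>
    2 * real (card (graphs n)) *
      (2 ^ s * (31 / 32) ^ m + 4 ^ m * (3 / 4) ^ (n - 1 - 2 * m) + 16 * real n ^ 3 * (10 / 11) ^ s)"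
proof -
  define K :: real where "K = (11 / 10) ^ s / 2"
  define r where "r = n - 1 - 2 * m"
  have K: "K > 0" by (simp add: K_def)
  have r: "2 * m + r < n" "2 * m + r = n - 1" using n by (auto simp: r_def)
  let ?G = "graphs n"
  define X where "X = (\<lambda>\<kappa>. {E \<in> ?G. rejects n \<kappa> m E r \<noteq> {}} \<union>
     {E \<in> ?G. real (nstates n \<kappa> E (phase2 n \<kappa> m E r)) < K / 2})"
  have fX: "finite (X \<kappa>)" for \<kappa> by (simp add: X_def finite_graphs)
  have "{E \<in> ?G. \<not> even_degenerate n E} \<subseteq> X True \<union> X False"
  proof
    fix E assume "E \<in> {E \<in> ?G. \<not> even_degenerate n E}"
    then have E: "E \<subseteq> all_edges n" "E \<in> ?G" "\<not> even_degenerate n E" by (auto simp: graphs_def)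
    let ?\<kappa> = "odd_edges E {..<n}"
    have "E \<in> X ?\<kappa>"
    proof (rule ccontr)
      assume "E \<notin> X ?\<kappa>"
      then have 1: "rejects n ?\<kappa> m E r = {}" "K / 2 \<le> real (nstates n ?\<kappa> E (phase2 n ?\<kappa> m E r))"
        using E by (auto simp: X_def)
      \<comment> \<open>No rejected vertex is left and the fresh vertices below
        \<open>2 * m + r = n - 1\<close> have been removed.\<close>
      have "phase2 n ?\<kappa> m E r \<subseteq> {n - 1}"
      proof
        fix u assume u: "u \<in> phase2 n ?\<kappa> m E r"
        then have "\<not> u < 2 * m" "\<not> (2 * m \<le> u \<and> u < 2 * m + r)" "u < n"
          using 1(1) phase2_gap[of n ?\<kappa> m E r] phase2_subset[of n ?\<kappa> m E r]
          by (auto simp: rejects_def)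
        then show "u \<in> {n - 1}" using r by auto
      qed
      moreover have "n - 1 \<in> phase2 n ?\<kappa> m E r"
        using phase2_superset[of m r n ?\<kappa> E] r n by auto
      ultimately have "phase2 n ?\<kappa> m E r = {n - 1}" by auto
      then have "card (states {..<n} ?\<kappa> E {n - 1}) \<noteq> 0" using 1(2) K by (auto simp: nstates_def)
      then have "states {..<n} ?\<kappa> E {n - 1} \<noteq> {}" by auto
      then show False using even_degenerate_if_states[OF E(1), of "n - 1"] E(3) n by simp
    qed
    then show "E \<in> X True \<union> X False" by (cases ?\<kappa>) auto
  qed
  then have "card {E \<in> ?G. \<not> even_degenerate n E} \<le> card (X True \<union> X False)"
    by (intro card_mono) (simp_all add: fX)
  also have "\<dots> \<le> card (X True) + card (X False)" by (rule card_Un_le)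
  finally have split: "real (card {E \<in> ?G. \<not> even_degenerate n E}) \<le> real (card (X True)) + real (card (X False))"
    by linarith
  have X: "real (card (X \<kappa>)) \<le> real (card ?G) *
      (2 ^ s * (31 / 32) ^ m + 4 ^ m * (3 / 4) ^ r + 16 * real n ^ 3 * (10 / 11) ^ s)" for \<kappa>
  proof -
    have "{E \<in> ?G. real (nstates n \<kappa> E (phase1 n \<kappa> E m)) < K}
        \<subseteq> {E \<in> ?G. n - card (phase1 n \<kappa> E m) < s}"
    proof
      fix E assume E: "E \<in> {E \<in> ?G. real (nstates n \<kappa> E (phase1 n \<kappa> E m)) < K}"
      let ?t = "n - card (phase1 n \<kappa> E m)"
      have "?t < s"
      proof (rule ccontr)
        assume "\<not> ?t < s"
        then have t: "s \<le> ?t" by simp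
        \<comment> \<open>Here \<open>0 < s\<close> enters: at least one pair was accepted, so the
          growth bound applies.\<close>
        have "phase1 n \<kappa> E m \<noteq> {..<n}"
        proof
          assume "phase1 n \<kappa> E m = {..<n}"
          then show False using t s by simp
        qed
        moreover have "2 * m < n" using n by simp
        ultimately have "(11 / 10) ^ ?t \<le> 2 * real (nstates n \<kappa> E (phase1 n \<kappa> E m))"
          using phase1_many_states[of m n \<kappa> E] by blast
        moreover have "(11 / 10 :: real) ^ s \<le> (11 / 10) ^ ?t" using t by (intro power_increasing) auto
        ultimately show False using E unfolding K_def mem_Collect_eq by linarith
      qed
      then show "E \<in> {E \<in> ?G. n - card (phase1 n \<kappa> E m) < s}" using E by auto
    qed
    then have "card {E \<in> ?G. real (nstates n \<kappa> E (phase1 n \<kappa> E m)) < K}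
        \<le> card {E \<in> ?G. n - card (phase1 n \<kappa> E m) < s}"
      by (intro card_mono) (simp_all add: finite_graphs)
    moreover have "real (card {E \<in> ?G. n - card (phase1 n \<kappa> E m) < s}) \<le> 2 ^ s * (31 / 32) ^ m * real (card ?G)"
      using n by (intro card_phase1_short) simp
    ultimately have 1: "real (card {E \<in> ?G. real (nstates n \<kappa> E (phase1 n \<kappa> E m)) < K})
        \<le> 2 ^ s * (31 / 32) ^ m * real (card ?G)" by linarith
    have "8 * real n ^ 3 / K = 16 * real n ^ 3 * (10 / 11) ^ s"
      by (simp add: K_def power_divide)
    then have 2: "real (card {E \<in> ?G. real (nstates n \<kappa> E (phase2 n \<kappa> m E r)) < K / 2})
        \<le> 2 ^ s * (31 / 32) ^ m * real (card ?G) + 16 * real n ^ 3 * (10 / 11) ^ s * real (card ?G)"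
      using card_few_states[OF r(1) K, of \<kappa>] 1 by simp
    have "card (X \<kappa>) \<le> card {E \<in> ?G. rejects n \<kappa> m E r \<noteq> {}}
        + card {E \<in> ?G. real (nstates n \<kappa> E (phase2 n \<kappa> m E r)) < K / 2}"
      unfolding X_def by (rule card_Un_le)
    then have "real (card (X \<kappa>)) \<le> 4 ^ m * (3 / 4) ^ r * real (card ?G)
        + (2 ^ s * (31 / 32) ^ m * real (card ?G) + 16 * real n ^ 3 * (10 / 11) ^ s * real (card ?G))"
      using card_rejects[OF r(1), of \<kappa>] 2 by linarith
    then show ?thesis by (simp add: algebra_simps)
  qed
  show ?thesis using split X[of True] X[of False] unfolding r_def by (simp add: algebra_simps)
qed

section \<open>The lower bound\<close>

text \<open>The first vertex of \<open>K\<close> in any order has all its neighbours in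
  \<open>K\<close> later and no neighbours outside \<open>K\<close>, so an odd number of later
  neighbours.\<close>

lemma not_even_degenerate_if_odd_core:
  assumes E: "E \<subseteq> all_edges n" and K: "K \<subseteq> {..<n}" "3 \<le> card K"
    and odd: "\<And>v. v \<in> K \<Longrightarrow> odd_deg E v K"
    and sep: "\<And>u v. v \<in> K \<Longrightarrow> u \<notin> K \<Longrightarrow> {u, v} \<notin> E"
  shows "\<not> even_degenerate n E"
proof
  assume "even_degenerate n E"
  then obtain vs where vs: "distinct vs" "set vs = {..<n}"
    and ev: "\<And>i. i + 2 < n \<Longrightarrow> even (card {j. i < j \<and> j < n \<and> {vs ! i, vs ! j} \<in> E})"
    by (auto simp: even_degenerate_def)
  have len: "length vs = n" using distinct_card[OF vs(1)] vs(2) by simp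
  have pos: "\<exists>j<n. vs ! j = u" if "u \<in> K" for u
    using that K(1) vs(2) len by (metis in_set_conv_nth subsetD)
  define i where "i = (LEAST i. i < n \<and> vs ! i \<in> K)"
  have "K \<noteq> {}" using K(2) by auto
  then have ex: "\<exists>i. i < n \<and> vs ! i \<in> K" using pos by blast
  have i: "i < n" "vs ! i \<in> K" using LeastI_ex[OF ex] by (auto simp: i_def)
  have least: "i \<le> j" if "j < n" "vs ! j \<in> K" for j
    unfolding i_def using that by (intro Least_le) auto
  \<comment> \<open>\<open>K\<close> occupies positions from \<open>i\<close> on; having three
    elements puts \<open>i\<close> among the positions subject to the parity condition.\<close>
  have "K \<subseteq> (!) vs ` {i..<n}" using pos least by fastforce
  then have "card K \<le> card ((!) vs ` {i..<n})" by (intro card_mono) auto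
  also have "\<dots> \<le> n - i" using card_image_le[of "{i..<n}" "(!) vs"] by simp
  finally have i2: "i + 2 < n" using K(2) by simp
  have "bij_betw ((!) vs) {j. i < j \<and> j < n \<and> {vs ! i, vs ! j} \<in> E} {u \<in> K. {u, vs ! i} \<in> E}"
  proof (rule bij_betw_imageI)
    show "inj_on ((!) vs) {j. i < j \<and> j < n \<and> {vs ! i, vs ! j} \<in> E}"
      using vs(1) len by (intro inj_on_nth) auto
    show "(!) vs ` {j. i < j \<and> j < n \<and> {vs ! i, vs ! j} \<in> E} = {u \<in> K. {u, vs ! i} \<in> E}"
    proof (intro subset_antisym subsetI)
      fix u assume "u \<in> (!) vs ` {j. i < j \<and> j < n \<and> {vs ! i, vs ! j} \<in> E}"
      then have "{u, vs ! i} \<in> E" by (auto simp: insert_commute)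
      then show "u \<in> {u \<in> K. {u, vs ! i} \<in> E}" using sep[OF i(2)] by auto
    next
      fix u assume u: "u \<in> {u \<in> K. {u, vs ! i} \<in> E}"
      then obtain j where j: "j < n" "vs ! j = u" using pos by auto
      have "j \<noteq> i" using u j no_loops[OF E] by auto
      then have "i < j" using least[of j] u j by auto
      then show "u \<in> (!) vs ` {j. i < j \<and> j < n \<and> {vs ! i, vs ! j} \<in> E}"
        using u j by (intro image_eqI[of _ _ j]) (auto simp: insert_commute)
    qed
  qed
  from bij_betw_same_card[OF this] show False
    using ev[OF i2] odd[OF i(2)] by (simp add: odd_deg_def)
qed

text \<open>Handshaking: in the induction each edge at the new vertex adds \<open>2\<close> to the
  degree sum.\<close>

lemma even_card_odd_degree:
  assumes "finite K" and loops: "\<And>v. {v, v} \<notin> E"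
  shows "even (card {v \<in> K. odd_deg E v K})"
proof -
  have "even (\<Sum>v\<in>K. card {u \<in> K. {u, v} \<in> E})"
    using assms(1)
  proof (induction K)
    case (insert x K)
    let ?a = "\<lambda>v. if {x, v} \<in> E then 1 else 0 :: nat"
    have 1: "card {u \<in> insert x K. {u, v} \<in> E} = card {u \<in> K. {u, v} \<in> E} + ?a v" for v
    proof -
      have "{u \<in> insert x K. {u, v} \<in> E}
          = (if {x, v} \<in> E then insert x {u \<in> K. {u, v} \<in> E} else {u \<in> K. {u, v} \<in> E})" by auto
      then show ?thesis using insert by simp
    qed
    have 2: "card {u \<in> K. {u, x} \<in> E} = (\<Sum>v\<in>K. ?a v)"
      using insert by (simp add: sum.If_cases Int_def insert_commute)
    have "(\<Sum>v\<in>insert x K. card {u \<in> insert x K. {u, v} \<in> E})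
        = 2 * (\<Sum>v\<in>K. ?a v) + (\<Sum>v\<in>K. card {u \<in> K. {u, v} \<in> E})"
      unfolding 1 using insert 2 loops[of x] by (simp add: sum.distrib)
    then show ?case using insert by simp
  qed simp
  then show ?thesis using assms(1) by (simp add: even_sum_iff odd_deg_def)
qed

lemma all_edges_Suc: "all_edges (Suc n) = all_edges n \<union> (\<lambda>u. {u, n}) ` {..<n}"
  by (auto simp: all_edges_def less_Suc_eq)

lemma card_all_edges_Suc_le: "card (all_edges (Suc n)) \<le> card (all_edges n) + n"
  unfolding all_edges_Suc using card_Un_le[of "all_edges n"] card_image_le[of "{..<n}" "\<lambda>u. {u, n}"]
  by (metis (no_types, lifting) add_left_mono card_lessThan finite_lessThan le_trans)

lemma all_edges_mono: "t \<le> n \<Longrightarrow> all_edges t \<subseteq> all_edges n"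
  by (auto simp: all_edges_def intro: less_le_trans)

text \<open>Joining \<open>t\<close> to the vertices of even degree makes all degrees below
  \<open>t\<close> odd; as \<open>t\<close> is odd, handshaking makes the degree of \<open>t\<close>
  odd too. Vertices above \<open>t\<close> are isolated, and \<open>F\<close> remains readable from
  \<open>E\<close>.\<close>

lemma odd_extension:
  assumes t: "odd t" "2 \<le> t" "t < n" and F: "F \<subseteq> all_edges t"
  defines "E \<equiv> F \<union> {e. \<exists>i<t. \<not> odd_deg F i {..<t} \<and> e = {i, t}}"
  shows "E \<in> graphs n" "\<not> even_degenerate n E" "E \<inter> all_edges t = F"
proof -
  have "{i, t} \<notin> all_edges t" for i by (auto simp: all_edges_def doubleton_eq_iff)
  then show int: "E \<inter> all_edges t = F" using F by (auto simp: E_def)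
  have sub: "E \<subseteq> all_edges n"
    using F all_edges_mono[of t n] t by (auto simp: E_def intro: all_edgesI)
  then show "E \<in> graphs n" by (simp add: graphs_def)
  have Ft: "{u, v} \<notin> F" if "t \<le> u" for u v
    using that F by (auto simp: all_edges_def doubleton_eq_iff dest!: subsetD)
  have E_in: "{u, i} \<in> E \<longleftrightarrow> {u, i} \<in> F" if "i < t" "u < t" for i u
    using that by (auto simp: E_def doubleton_eq_iff)
  have E_t: "{t, i} \<in> E \<longleftrightarrow> \<not> odd_deg F i {..<t}" if "i < t" for i
    using that Ft[of t i] by (auto simp: E_def doubleton_eq_iff)
  let ?K = "insert t {..<t}"
  have low: "odd_deg E i ?K" if "i < t" for i
  proof -
    have "{u \<in> {..<t}. {u, i} \<in> E} = {u \<in> {..<t}. {u, i} \<in> F}" using E_in[OF that] by auto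
    then have "odd_deg E i {..<t} = odd_deg F i {..<t}" by (simp add: odd_deg_def)
    then show ?thesis using odd_deg_insert[of "{..<t}" t E i] E_t[OF that] by simp
  qed
  have top: "odd_deg E t ?K"
  proof (rule ccontr)
    assume "\<not> odd_deg E t ?K"
    then have "{v \<in> ?K. odd_deg E v ?K} = {..<t}" using low by auto
    moreover have "even (card {v \<in> ?K. odd_deg E v ?K})"
      by (rule even_card_odd_degree) (use no_loops[OF sub] in auto)
    ultimately show False using t(1) by simp
  qed
  show "\<not> even_degenerate n E"
  proof (rule not_even_degenerate_if_odd_core[OF sub, of ?K])
    show "?K \<subseteq> {..<n}" "3 \<le> card ?K" using t by auto
    show "odd_deg E v ?K" if "v \<in> ?K" for v using that low top by auto
    show "{u, v} \<notin> E" if "v \<in> ?K" "u \<notin> ?K" for u v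
      using that Ft[of u v] by (auto simp: E_def doubleton_eq_iff)
  qed
qed

text \<open>The extension is injective on graphs with \<open>t\<close> vertices, and going from
  \<open>t\<close> to \<open>n \<le> t + 2\<close> vertices adds at most \<open>2 * n\<close>
  possible edges.\<close>

lemma card_not_even_degenerate_ge:
  assumes n: "4 \<le> n"
  shows "real (card (graphs n)) \<le> 4 ^ n * real (card {E \<in> graphs n. \<not> even_degenerate n E})"
proof -
  define t where "t = (if even n then n - 1 else n - 2)"
  have t: "odd t" "2 \<le> t" "t < n" "n \<le> t + 2" using n by (auto simp: t_def)
  define f where "f = (\<lambda>F. F \<union> {e. \<exists>i<t. \<not> odd_deg F i {..<t} \<and> e = {i, t}})"
  have "inj_on f (Pow (all_edges t))"
    by (rule inj_on_inverseI[where g = "\<lambda>E. E \<inter> all_edges t"])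
      (use odd_extension(3)[OF t(1-3)] in \<open>auto simp: f_def\<close>)
  then have "card (Pow (all_edges t)) = card (f ` Pow (all_edges t))" by (simp add: card_image)
  also have "\<dots> \<le> card {E \<in> graphs n. \<not> even_degenerate n E}"
    using odd_extension(1,2)[OF t(1-3)]
    by (intro card_mono) (auto simp: f_def finite_graphs)
  finally have 1: "2 ^ card (all_edges t) \<le> card {E \<in> graphs n. \<not> even_degenerate n E}"
    by (simp add: card_Pow finite_all_edges)
  have "card (all_edges n) \<le> card (all_edges (Suc (Suc t)))"
    using t by (intro card_mono finite_all_edges all_edges_mono) simp
  also have "\<dots> \<le> card (all_edges t) + 2 * n"
    using card_all_edges_Suc_le[of t] card_all_edges_Suc_le[of "Suc t"] t(3) by linarith
  finally have "card (graphs n) \<le> 2 ^ (card (all_edges t) + 2 * n)"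
    unfolding graphs_def card_Pow[OF finite_all_edges] by (intro power_increasing) auto
  also have "\<dots> = 4 ^ n * 2 ^ card (all_edges t)" by (simp add: power_add power_mult)
  also have "\<dots> \<le> 4 ^ n * card {E \<in> graphs n. \<not> even_degenerate n E}" using 1 by simp
  finally have "real (card (graphs n)) \<le> real (4 ^ n * card {E \<in> graphs n. \<not> even_degenerate n E})"
    by (simp only: of_nat_le_iff)
  then show ?thesis by simp
qed

section \<open>The probability bounds\<close>

lemma prob_Gnp_half:
  "measure_pmf.prob (Gnp_half n) {E. P E} = real (card {E \<in> graphs n. P E}) / real (card (graphs n))"
proof -
  have "graphs n \<noteq> {}" by (auto simp: graphs_def)
  moreover have "graphs n \<inter> {E. P E} = {E \<in> graphs n. P E}" by auto
  ultimately show ?thesis unfolding Gnp_half_def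
    by (simp add: measure_pmf_of_set finite_graphs)
qed

text \<open>Since \<open>10 / 11 = 19 / 20 * (200 / 209)\<close>, a geometric factor is left over to
  absorb the cubic polynomial.\<close>

lemma eventually_tail_bound:
  "\<forall>\<^sub>F s in sequentially. 2 * ((10 / 11) ^ s + 4 / 3 * (10 / 11) ^ s
     + 16 * (240 * (real s + 1)) ^ 3 * (10 / 11) ^ s) \<le> (19 / 20) ^ s"
proof -
  have "\<forall>\<^sub>F s::nat in sequentially. (14 / 3 + 32 * (240 * (real s + 1)) ^ 3) * (200 / 209) ^ s \<le> 1"
    by real_asymp
  then show ?thesis
  proof (rule eventually_mono)
    fix s :: nat
    assume "(14 / 3 + 32 * (240 * (real s + 1)) ^ 3) * (200 / 209) ^ s \<le> 1"
    then have "(19 / 20) ^ s * ((14 / 3 + 32 * (240 * (real s + 1)) ^ 3) * (200 / 209) ^ s) \<le> (19 / 20) ^ s * 1"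
      by (rule mult_left_mono) simp
    moreover have "(10 / 11 :: real) ^ s = (19 / 20) ^ s * (200 / 209) ^ s"
      by (simp flip: power_mult_distrib)
    ultimately show "2 * ((10 / 11) ^ s + 4 / 3 * (10 / 11) ^ s
        + 16 * (240 * (real s + 1)) ^ 3 * (10 / 11) ^ s) \<le> (19 / 20) ^ s"
      by (simp add: algebra_simps)
  qed
qed

theorem mainTheorem4:
  shows "\<exists>c C :: real. \<exists>n0 :: nat. 0 < c \<and> c < C \<and>
    (\<forall>n \<ge> n0.
       exp (- C * real n) \<le> measure_pmf.prob (Gnp_half n) {E. \<not> even_degenerate n E} \<and>
       measure_pmf.prob (Gnp_half n) {E. \<not> even_degenerate n E} \<le> exp (- c * real n))"
proof -
  obtain s0 :: nat where s0: "\<And>s. s \<ge> s0 \<Longrightarrow> 2 * ((10 / 11) ^ s + 4 / 3 * (10 / 11) ^ s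
     + 16 * (240 * (real s + 1)) ^ 3 * (10 / 11) ^ s) \<le> (19 / 20 :: real) ^ s"
    using eventually_tail_bound unfolding eventually_sequentially by blast
  define n0 where "n0 = 240 * (s0 + 1)"
  have "exp (- 2 * real n) \<le> measure_pmf.prob (Gnp_half n) {E. \<not> even_degenerate n E} \<and>
       measure_pmf.prob (Gnp_half n) {E. \<not> even_degenerate n E} \<le> exp (- (1 / 9600) * real n)"
    if n: "n \<ge> n0" for n
  proof
    define b where "b = real (card {E \<in> graphs n. \<not> even_degenerate n E})"
    define g where "g = real (card (graphs n))"
    have g: "g > 0" by (auto simp: g_def card_gt_0_iff finite_graphs) (auto simp: graphs_def)
    have p: "measure_pmf.prob (Gnp_half n) {E. \<not> even_degenerate n E} = b / g"
      by (simp add: prob_Gnp_half b_def g_def)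
    have "(4 :: real) ^ n \<le> exp 2 ^ n"
    proof (rule power_mono)
      have "(2 :: real) * 2 \<le> exp 1 * exp 1"
        using exp_ge_add_one_self[of 1] by (intro mult_mono) auto
      then show "(4 :: real) \<le> exp 2" by (simp flip: exp_add)
    qed simp
    then have e2: "(4 :: real) ^ n \<le> exp (2 * real n)" by (simp add: exp_of_nat_mult mult.commute)
    have "g \<le> 4 ^ n * b" unfolding g_def b_def
      by (rule card_not_even_degenerate_ge) (use n in \<open>simp add: n0_def\<close>)
    also have "\<dots> \<le> exp (2 * real n) * b" using e2 by (intro mult_right_mono) (auto simp: b_def)
    finally show "exp (- 2 * real n) \<le> measure_pmf.prob (Gnp_half n) {E. \<not> even_degenerate n E}"
      unfolding p using g by (simp add: exp_minus field_simps)
    \<comment> \<open>Phase 1 examines \<open>m = 30 * s\<close> pairs and aims at \<open>s\<close>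
      accepted vertices. The ratios are chosen so that \<open>2 * (31 / 32) ^ 30\<close> and
      \<open>4 ^ 30 * (3 / 4) ^ 180\<close> are both below \<open>10 / 11\<close>.\<close>
    define s where "s = n div 240"
    have s: "s \<ge> s0" "s \<ge> 1" "240 * s \<le> n" "n < 240 * (s + 1)"
      using n by (auto simp: s_def n0_def)
    have t1: "(2 :: real) ^ s * (31 / 32) ^ (30 * s) \<le> (10 / 11) ^ s"
    proof -
      have "(2 :: real) ^ s * (31 / 32) ^ (30 * s) = (2 * (31 / 32) ^ 30) ^ s"
        by (simp only: power_mult power_mult_distrib)
      also have "\<dots> \<le> (10 / 11) ^ s" by (intro power_mono) (simp_all add: power_divide)
      finally show ?thesis .
    qed
    have t2: "(4 :: real) ^ (30 * s) * (3 / 4) ^ (n - 1 - 2 * (30 * s)) \<le> 4 / 3 * (10 / 11) ^ s"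
    proof -
      \<comment> \<open>The vertex \<open>n - 1\<close> is never processed; this missing step costs
        the factor \<open>4 / 3\<close>.\<close>
      have "180 * s \<le> Suc (n - 1 - 2 * (30 * s))" using s by simp
      then have "(3 / 4 :: real) ^ Suc (n - 1 - 2 * (30 * s)) \<le> (3 / 4) ^ (180 * s)"
        by (intro power_decreasing) auto
      then have "(3 / 4 :: real) ^ (n - 1 - 2 * (30 * s)) \<le> 4 / 3 * (3 / 4) ^ (180 * s)" by simp
      then have "(4 :: real) ^ (30 * s) * (3 / 4) ^ (n - 1 - 2 * (30 * s))
          \<le> 4 ^ (30 * s) * (4 / 3 * (3 / 4) ^ (180 * s))" by (intro mult_left_mono) auto
      also have "\<dots> = 4 / 3 * (4 ^ 30 * (3 / 4) ^ 180) ^ s"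
        by (simp only: power_mult power_mult_distrib mult.left_commute)
      also have "\<dots> \<le> 4 / 3 * (10 / 11) ^ s"
        by (intro mult_left_mono power_mono) (simp_all add: power_divide)
      finally show ?thesis .
    qed
    have t3: "16 * real n ^ 3 * (10 / 11) ^ s \<le> 16 * (240 * (real s + 1)) ^ 3 * (10 / 11) ^ s"
      using s(4) by (intro mult_right_mono mult_left_mono power_mono) auto
    have "b \<le> 2 * g * (2 ^ s * (31 / 32) ^ (30 * s)
        + 4 ^ (30 * s) * (3 / 4) ^ (n - 1 - 2 * (30 * s)) + 16 * real n ^ 3 * (10 / 11) ^ s)"
      unfolding b_def g_def by (rule card_not_even_degenerate_le) (use s in auto)
    also have "\<dots> \<le> 2 * g * ((10 / 11) ^ s + 4 / 3 * (10 / 11) ^ s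
        + 16 * (240 * (real s + 1)) ^ 3 * (10 / 11) ^ s)"
      using t1 t2 t3 g by (intro mult_left_mono add_mono) auto
    also have "\<dots> \<le> g * (19 / 20) ^ s"
      using mult_left_mono[OF s0[OF s(1)], of g] g by (simp add: mult_ac)
    finally have "b / g \<le> (19 / 20) ^ s" using g by (simp add: field_simps)
    also have "\<dots> \<le> exp (- (1 / 20)) ^ s"
      using exp_ge_add_one_self[of "- (1 / 20) :: real"] by (intro power_mono) auto
    also have "\<dots> = exp (- (real s / 20))" by (simp flip: exp_of_nat_mult)
    \<comment> \<open>As \<open>s \<ge> 1\<close>, \<open>n < 240 * (s + 1) \<le> 480 * s\<close>,
      and \<open>9600 = 20 * 480\<close>.\<close>
    also have "\<dots> \<le> exp (- (1 / 9600) * real n)" using s by simp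
    finally show "measure_pmf.prob (Gnp_half n) {E. \<not> even_degenerate n E} \<le> exp (- (1 / 9600) * real n)"
      unfolding p .
  qed
  then show ?thesis by (intro exI[of _ "1 / 9600"] exI[of _ 2] exI[of _ n0]) auto
qed

end
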